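(* Choices of minimal kinematics on $\mathcal{M}_{0,n}$, i.e. subsets $T\subseteq S$ that exhibit minimal kinematics for $\mathcal{M}_{0,n}$, are in bijection with 2-trees on $[n-1]=\{1,2,\dots,n-1\}$. Here a 2-tree is identified with a subset of $S$ by removing the initial edge $12$ from its edge set.
   Context: Let $n\ge 4$. Coordinates on $\mathcal{M}_{0,n}$. Let $x_1,\dots,x_{n-3}$ be complex coordinates and let $$X=\begin{bmatrix}1&1&1&1&\cdots&1&0\\0&1&x_1&x_2&\cdots&x_{n-3}&1\end{bmatrix}.$$ For $1\le i<j\le n$ let $p_{ij}$ be the $2\times 2$ minor of $X$ with columns $i,j$. The moduli space $\mathcal{M}_{0,n}$ of $n$ labeled points on $\mathbb{P}^1$ is identified with the set of $x\in\mathbb{C}^{n-3}$ such that all $p_{ij}\neq 0$. Index set of non-constant minors: $S=\{(i,j):1\le i<j\le n-1\}\setminus\{(1,2)\}$. Restricted scattering potential. For a subset $T\subseteq S$ and complex parameters $s=(s_{ij})_{(i,j)\in T}$ put $$L_T=\sum_{(i,j)\in T}s_{ij}\log(p_{ij}),$$ a (multivalued) function of $x\in\mathbb{C}^{n-3}$ on the locus where $p_{ij}\ne0$ for all $(i,j)\in T$. Its critical points are the points of this locus where $\partial L_T/\partial x_1=\dots=\partial L_T/\partial x_{n-3}=0$; this does not depend on the choice of branches of the logarithm. Minimal kinematics. A subset $T\subseteq S$ exhibits minimal kinematics for $\mathcal{M}_{0,n}$ if, for general $s$, the function $L_T$ has exactly one critical point (which is hence rational in the $s_{ij}$), and $T$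 is inclusion-maximal with this property. 2-trees. A 2-tree on $[n-1]$ is a graph with $2n-5$ edges on the vertex set $[n-1]$ which can be constructed inductively as follows. Start with the single edge graph $\{12\}$, which is the unique 2-tree for $n-1=2$. For $k=3,4,5,\dots,n-1$, in this order, select an edge $ij$ of the graph constructed so far, whose vertices $i$ and $j$ are in $\{1,\dots,k-1\}$, and introduce the two new edges $ik$ and $jk$. There are $2k-5$ choices at this stage, so the process leads to $(2n-7)!!=1\cdot3\cdot5\cdots(2n-7)$ distinct 2-trees. Edges are identified with pairs $(i,j)$, $i<j$.
   Formalization: The vertices 3,…,n−1 of a 2-tree may be attached in any order, so all labelled 2-trees containing the edge 12 count; with "in this order" the claim fails at n=5, where there are 5 choices of minimal kinematics (e.g. T={14,24,23,34}) but only 3 in-order 2-trees. *)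

theory Defs
  imports "HOL-Analysis.Analysis"
begin

section \<open>Coordinates\<close>

text \<open>
  A point of $\mathbb{C}^{n-3}$ is an extensional function on \<open>{1..n-3}\<close>; rows and columns
  of the matrix are numbered from 1, as are all other indices.
\<close>

definition points :: "nat \<Rightarrow> (nat \<Rightarrow> complex) set" where
  "points n = {1..n-3} \<rightarrow>\<^sub>E UNIV"

definition X_matrix :: "nat \<Rightarrow> (nat \<Rightarrow> complex) \<Rightarrow> nat \<Rightarrow> nat \<Rightarrow> complex" where
  "X_matrix n x r c =
     (if r = 1 then (if c = n then 0 else 1)
      else (if c = 1 then 0 else if c = 2 \<or> c = n then 1 else x (c - 2)))"

definition minor :: "nat \<Rightarrow> (nat \<Rightarrow> complex) \<Rightarrow> nat \<Rightarrow> nat \<Rightarrow> complex" where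
  "minor n x i j = X_matrix n x 1 i * X_matrix n x 2 j - X_matrix n x 1 j * X_matrix n x 2 i"

definition S_index :: "nat \<Rightarrow> (nat \<times> nat) set" where
  "S_index n = {(i, j). 1 \<le> i \<and> i < j \<and> j \<le> n - 1} - {(1, 2)}"


section \<open>Critical points of the scattering potential\<close>

definition log_branch_at :: "(complex \<Rightarrow> complex) \<Rightarrow> complex \<Rightarrow> bool" where
  "log_branch_at l w \<longleftrightarrow> l analytic_on {w} \<and> (\<forall>\<^sub>F z in nhds w. exp (l z) = z)"

text \<open>The potential $L_T$, with the function \<open>l e\<close> in the place of the logarithm of $p_e$.\<close>

definition potential ::
  "nat \<Rightarrow> (nat \<times> nat) set \<Rightarrow> (nat \<times> nat \<Rightarrow> complex) \<Rightarrow> (nat \<times> nat \<Rightarrow> complex \<Rightarrow> complex)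
     \<Rightarrow> (nat \<Rightarrow> complex) \<Rightarrow> complex" where
  "potential n T s l x = (\<Sum>(i, j)\<in>T. s (i, j) * l (i, j) (minor n x i j))"

text \<open>
  The branches are local, at the point in question. That their choice is immaterial is
  \<open>critical_point_iff_branch\<close> below.
\<close>

definition critical_point ::
  "nat \<Rightarrow> (nat \<times> nat) set \<Rightarrow> (nat \<times> nat \<Rightarrow> complex) \<Rightarrow> (nat \<Rightarrow> complex) \<Rightarrow> bool" where
  "critical_point n T s x \<longleftrightarrow>
     x \<in> points n \<and> (\<forall>(i, j)\<in>T. minor n x i j \<noteq> 0) \<and>
     (\<exists>l. (\<forall>(i, j)\<in>T. log_branch_at (l (i, j)) (minor n x i j)) \<and>
       (\<forall>k\<in>{1..n-3}.
          ((\<lambda>t. potential n T s l (x(k := t))) has_field_derivative 0) (at (x k))))"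

lemma log_branch_at_exists:
  assumes "w \<noteq> 0"
  shows "\<exists>l. log_branch_at l w"
proof -
  define l where "l = (\<lambda>z. Ln w + Ln (z / w))"
  have an: "l analytic_on {w}"
    unfolding l_def using assms
    by (intro analytic_intros) auto
  have "\<forall>\<^sub>F z in nhds w. z \<noteq> 0"
    using assms by (rule t1_space_nhds)
  then have "\<forall>\<^sub>F z in nhds w. exp (l z) = z"
    by eventually_elim (use assms in \<open>simp add: l_def exp_add\<close>)
  with an show ?thesis
    unfolding log_branch_at_def by blast
qed

lemma log_branch_at_derivative:
  assumes "log_branch_at l w" and "w \<noteq> 0"
  shows "(l has_field_derivative 1 / w) (at w)"
proof -
  from assms have an: "l analytic_on {w}" and ev: "\<forall>\<^sub>F z in nhds w. exp (l z) = z"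
    by (auto simp: log_branch_at_def)
  from an obtain d where d: "(l has_field_derivative d) (at w)"
    using analytic_at_imp_isCont analytic_on_imp_differentiable_at
    by (metis field_differentiable_def singletonI)
  have "((\<lambda>z. exp (l z)) has_field_derivative exp (l w) * d) (at w)"
    by (rule derivative_eq_intros d refl)+
  moreover have "((\<lambda>z. exp (l z)) has_field_derivative 1) (at w)"
    using DERIV_cong_ev[OF refl ev refl] by simp
  ultimately have "exp (l w) * d = 1"
    by (rule DERIV_unique)
  moreover have "exp (l w) = w"
    using ev by (rule eventually_nhds_x_imp_x)
  ultimately have "d = 1 / w"
    using assms(2) by (simp add: field_simps)
  with d show ?thesis by simp
qed

lemma minor_has_derivative:
  "((\<lambda>t. minor n (x(k := t)) i j) has_field_derivative
      deriv (\<lambda>t. minor n (x(k := t)) i j) a) (at a)"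
proof -
  have X: "(\<lambda>t. X_matrix n (x(k := t)) r c) field_differentiable at a" for r c
    by (cases "r = 1"; cases "c = 1"; cases "c = 2"; cases "c = n"; cases "c - 2 = k")
      (simp_all add: X_matrix_def)
  have "(\<lambda>t. minor n (x(k := t)) i j) field_differentiable at a"
    unfolding minor_def by (intro derivative_intros X)
  then show ?thesis
    by (simp add: DERIV_deriv_iff_field_differentiable)
qed

lemma potential_derivative:
  assumes nz: "\<forall>(i, j)\<in>T. minor n x i j \<noteq> 0"
    and br: "\<forall>(i, j)\<in>T. log_branch_at (l (i, j)) (minor n x i j)"
  shows "((\<lambda>t. potential n T s l (x(k := t))) has_field_derivative
    (\<Sum>(i, j)\<in>T. s (i, j) * deriv (\<lambda>t. minor n (x(k := t)) i j) (x k) / minor n x i j))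
    (at (x k))"
proof -
  have "((\<lambda>t. s (i, j) * l (i, j) (minor n (x(k := t)) i j)) has_field_derivative
      s (i, j) * deriv (\<lambda>t. minor n (x(k := t)) i j) (x k) / minor n x i j) (at (x k))"
    if "(i, j) \<in> T" for i j
  proof -
    have "(l (i, j) has_field_derivative 1 / minor n x i j) (at (minor n (x(k := x k)) i j))"
      using log_branch_at_derivative nz br that by fastforce
    from DERIV_chain2[OF this minor_has_derivative]
    have "((\<lambda>t. l (i, j) (minor n (x(k := t)) i j)) has_field_derivative
      1 / minor n x i j * deriv (\<lambda>t. minor n (x(k := t)) i j) (x k)) (at (x k))" .
    from DERIV_cmult[OF this, of "s (i, j)"] show ?thesis
      by (simp add: mult.commute)
  qed
  then show ?thesis
    unfolding potential_def case_prod_beta by (intro DERIV_sum) auto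
qed

lemma potential_critical_iff:
  assumes "\<forall>(i, j)\<in>T. minor n x i j \<noteq> 0"
    and "\<forall>(i, j)\<in>T. log_branch_at (l (i, j)) (minor n x i j)"
  shows "((\<lambda>t. potential n T s l (x(k := t))) has_field_derivative 0) (at (x k)) \<longleftrightarrow>
    (\<Sum>(i, j)\<in>T. s (i, j) * deriv (\<lambda>t. minor n (x(k := t)) i j) (x k) / minor n x i j) = 0"
    (is "?L \<longleftrightarrow> ?d = 0")
proof
  assume ?L
  from DERIV_unique[OF potential_derivative[OF assms] this] show "?d = 0" .
next
  assume d: "?d = 0"
  from potential_derivative[OF assms, of s k] show ?L unfolding d .
qed

lemma critical_point_iff:
  "critical_point n T s x \<longleftrightarrow>
     x \<in> points n \<and> (\<forall>(i, j)\<in>T. minor n x i j \<noteq> 0) \<and>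
     (\<forall>k\<in>{1..n-3}.
        (\<Sum>(i, j)\<in>T. s (i, j) * deriv (\<lambda>t. minor n (x(k := t)) i j) (x k) / minor n x i j) = 0)"
    (is "?L \<longleftrightarrow> ?R")
proof
  assume ?L
  then obtain l where nz: "\<forall>(i, j)\<in>T. minor n x i j \<noteq> 0"
    and br: "\<forall>(i, j)\<in>T. log_branch_at (l (i, j)) (minor n x i j)"
    and "x \<in> points n" "\<forall>k\<in>{1..n-3}.
       ((\<lambda>t. potential n T s l (x(k := t))) has_field_derivative 0) (at (x k))"
    unfolding critical_point_def by blast
  then show ?R unfolding potential_critical_iff[OF nz br] by blast
next
  assume R: ?R
  then have nz: "\<forall>(i, j)\<in>T. minor n x i j \<noteq> 0" by blast
  define l where "l = (\<lambda>(i, j). SOME l. log_branch_at l (minor n x i j))"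
  have br: "\<forall>(i, j)\<in>T. log_branch_at (l (i, j)) (minor n x i j)"
  proof (clarify)
    fix i j assume "(i, j) \<in> T"
    with nz have "minor n x i j \<noteq> 0" by blast
    from someI_ex[OF log_branch_at_exists[OF this]]
    show "log_branch_at (l (i, j)) (minor n x i j)" by (simp add: l_def)
  qed
  from R have "\<forall>k\<in>{1..n-3}.
       ((\<lambda>t. potential n T s l (x(k := t))) has_field_derivative 0) (at (x k))"
    unfolding potential_critical_iff[OF nz br] by blast
  with R br show ?L unfolding critical_point_def by blast
qed

lemma critical_point_iff_branch:
  assumes br: "\<forall>(i, j)\<in>T. log_branch_at (l (i, j)) (minor n x i j)"
  shows "critical_point n T s x \<longleftrightarrow>
     x \<in> points n \<and> (\<forall>(i, j)\<in>T. minor n x i j \<noteq> 0) \<and>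
     (\<forall>k\<in>{1..n-3}. ((\<lambda>t. potential n T s l (x(k := t))) has_field_derivative 0) (at (x k)))"
proof (cases "\<forall>(i, j)\<in>T. minor n x i j \<noteq> 0")
  case nz: True
  show ?thesis
    unfolding critical_point_iff potential_critical_iff[OF nz br] ..
next
  case False
  then show ?thesis
    unfolding critical_point_def by blast
qed


section \<open>General parameters and minimal kinematics\<close>

inductive_set polynomial_functions :: "'i set \<Rightarrow> (('i \<Rightarrow> complex) \<Rightarrow> complex) set"
  for I :: "'i set" where
  const: "(\<lambda>_. c) \<in> polynomial_functions I"
| var: "i \<in> I \<Longrightarrow> (\<lambda>s. s i) \<in> polynomial_functions I"
| add: "f \<in> polynomial_functions I \<Longrightarrow> g \<in> polynomial_functions I
    \<Longrightarrow> (\<lambda>s. f s + g s) \<in> polynomial_functions I"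
| mult: "f \<in> polynomial_functions I \<Longrightarrow> g \<in> polynomial_functions I
    \<Longrightarrow> (\<lambda>s. f s * g s) \<in> polynomial_functions I"

text \<open>
  \<open>P\<close> holds for general $s \in \mathbb{C}^I$: it holds outside the zero set of some nonzero
  polynomial, i.e. on a dense Zariski open subset of $\mathbb{C}^I$.
\<close>

definition for_general :: "'i set \<Rightarrow> (('i \<Rightarrow> complex) \<Rightarrow> bool) \<Rightarrow> bool" where
  "for_general I P \<longleftrightarrow>
     (\<exists>f\<in>polynomial_functions I. (\<exists>s\<in>I \<rightarrow>\<^sub>E UNIV. f s \<noteq> 0) \<and>
        (\<forall>s\<in>I \<rightarrow>\<^sub>E UNIV. f s \<noteq> 0 \<longrightarrow> P s))"

definition one_critical_point :: "nat \<Rightarrow> (nat \<times> nat) set \<Rightarrow> bool" where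
  "one_critical_point n T \<longleftrightarrow> for_general T (\<lambda>s. \<exists>!x. critical_point n T s x)"

definition minimal_kinematics :: "nat \<Rightarrow> (nat \<times> nat) set \<Rightarrow> bool" where
  "minimal_kinematics n T \<longleftrightarrow>
     T \<subseteq> S_index n \<and> one_critical_point n T \<and>
     (\<forall>T'. T \<subset> T' \<and> T' \<subseteq> S_index n \<longrightarrow> \<not> one_critical_point n T')"


section \<open>2-trees\<close>

definition edge :: "nat \<Rightarrow> nat \<Rightarrow> nat \<times> nat" where
  "edge i j = (min i j, max i j)"

text \<open>
  \<open>two_tree V E\<close>: the graph with vertex set \<open>V\<close> and edge set \<open>E\<close> is obtained from the single
  edge 12 by successively attaching a new vertex \<open>k\<close> to both ends of an existing edge.
  Vertices other than 1 and 2 may be attached in any order, so these are all the labelled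
  2-trees that contain the edge 12. Attaching them only in the order \<open>3, 4, 5, \<dots>\<close> would lose
  some: on the vertices \<open>{1,2,3,4}\<close>, the 2-tree with edges 12, 14, 24, 23, 34, in which 4 must
  be attached before 3.
\<close>

inductive two_tree :: "nat set \<Rightarrow> (nat \<times> nat) set \<Rightarrow> bool" where
  single_edge: "two_tree {1, 2} {(1, 2)}"
| attach: "two_tree V E \<Longrightarrow> (i, j) \<in> E \<Longrightarrow> k \<notin> V
    \<Longrightarrow> two_tree (insert k V) (E \<union> {edge i k, edge j k})"

definition two_trees :: "nat \<Rightarrow> (nat \<times> nat) set set" where
  "two_trees m = {E. two_tree {1..m} E}"

end

theory Submission
  imports Defs
begin

text \<open>
  Put \<open>y 1 = 0\<close>, \<open>y 2 = 1\<close> and \<open>y (k + 2) = x k\<close>. Then the minor \<open>p_ij\<close> is \<open>y j - y i\<close>, and a critical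
  point of \<open>L_T\<close> is an equilibrium of the graph \<open>G = T \<union> {12}\<close>: at every vertex other than 1 and 2
  the forces \<open>s_ij / (y_i - y_j)\<close> exerted along the edges add up to zero. The edge 12 contributes
  nothing and its weight is arbitrary.

  2-trees have one critical point. A vertex \<open>k\<close> whose only edges are \<open>ik\<close> and \<open>jk\<close>, of weights \<open>a\<close> and \<open>b\<close>,
  is in equilibrium exactly at \<open>y k = (a * y j + b * y i) / (a + b)\<close>, and there it acts on \<open>i\<close> and \<open>j\<close>
  like an edge \<open>ij\<close> of weight \<open>a + b\<close> (\<open>equilibrium_attach_iff\<close>). Removing the vertices of a 2-tree in
  the reverse order of their attachment leaves the edge 12, whose equilibrium is unique; what has
  to be excluded on the way are the zeros of some linear forms in the weights.

  Conversely, if \<open>T\<close> generically has one critical point, then \<open>G\<close> is contained in a 2-tree. A nonzero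
  polynomial is nonzero at some point with positive integer coordinates, so there are positive
  weights with a unique equilibrium. It is real, because its complex conjugate is an equilibrium
  too. As the forces balance, every vertex other than 1 and 2 has a neighbour on either side: the
  positions are a bipolar labelling, whose orientation of the edges from smaller to larger position
  has 1 as its only source and 2 as its only sink. Every bipolar labelling \<open>z\<close> arises in this way up
  to orientation: the product of the \<open>\<bar>y_i - y_j\<bar> ^ w_ij\<close> has a maximum on the compact closure of the
  region of labellings oriented as \<open>z\<close>, and this maximum is an equilibrium
  (\<open>orientation_has_equilibrium\<close>). So \<open>G\<close> has only one bipolar orientation.

  If there are vertices besides 1 and 2, one of them has degree two
  (\<open>unique_orientation_series_vertex\<close>). Otherwise every vertex besides 1 and 2 has two lower or
  two upper neighbours; if \<open>v\<close> is the lowest vertex with two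
  lower neighbours and \<open>u\<close> is its highest lower neighbour, then reversing the edge \<open>uv\<close> gives a second
  bipolar orientation. Replacing \<open>k\<close> and its two edges \<open>ik\<close>, \<open>jk\<close> by an edge \<open>ij\<close> keeps the orientation
  unique, so by induction the smaller graph lies in a 2-tree, to which \<open>k\<close> can be attached at \<open>ij\<close>.

  All 2-trees on \<open>m\<close> vertices have \<open>2 * m - 3\<close> edges, so none is properly contained in another, and the
  inclusion-maximal sets with one critical point are exactly the 2-trees without the edge 12.
\<close>


section \<open>Critical points as equilibria of a graph\<close>

text \<open>
  The summand of an edge \<open>ij\<close> at its end \<open>v\<close> is \<open>w_ij / (y_v - y_u)\<close>, where \<open>u\<close> is the other end; the
  indicators express this symmetrically in \<open>i\<close> and \<open>j\<close>.
\<close>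

definition force :: "(nat \<times> nat) set \<Rightarrow> (nat \<times> nat \<Rightarrow> 'a::field) \<Rightarrow> (nat \<Rightarrow> 'a) \<Rightarrow> nat \<Rightarrow> 'a" where
  "force E w y v = (\<Sum>(i, j)\<in>E. w (i, j) * (of_bool (j = v) - of_bool (i = v)) / (y j - y i))"

definition equilibrium ::
  "nat set \<Rightarrow> (nat \<times> nat) set \<Rightarrow> (nat \<times> nat \<Rightarrow> 'a::field) \<Rightarrow> (nat \<Rightarrow> 'a) \<Rightarrow> bool" where
  "equilibrium V E w y \<longleftrightarrow> y 1 = 0 \<and> y 2 = 1 \<and> (\<forall>(i, j)\<in>E. y i \<noteq> y j) \<and>
     (\<forall>v\<in>V - {1, 2}. force E w y v = 0)"

text \<open>
  An equilibrium constrains a labelling on \<open>V\<close> only; extensionality fixes it elsewhere, so that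
  uniqueness makes sense.
\<close>

definition unique_equilibrium ::
  "nat set \<Rightarrow> (nat \<times> nat) set \<Rightarrow> (nat \<times> nat \<Rightarrow> complex) \<Rightarrow> bool" where
  "unique_equilibrium V E w \<longleftrightarrow> (\<exists>!y. y \<in> extensional V \<and> equilibrium V E w y)"

definition based_graph :: "nat set \<Rightarrow> (nat \<times> nat) set \<Rightarrow> bool" where
  "based_graph V E \<longleftrightarrow> finite V \<and> {1, 2} \<subseteq> V \<and> (1, 2) \<in> E \<and> E \<subseteq> {(i, j). i \<in> V \<and> j \<in> V \<and> i < j}"

lemma based_graph_finite:
  assumes "based_graph V E"
  shows "finite E"
proof (rule finite_subset)
  show "E \<subseteq> V \<times> V" using assms by (auto simp: based_graph_def)
  show "finite (V \<times> V)" using assms by (auto simp: based_graph_def)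
qed

definition positions :: "nat \<Rightarrow> (nat \<Rightarrow> complex) \<Rightarrow> nat \<Rightarrow> complex" where
  "positions n x = (\<lambda>v\<in>{1..n-1}. if v = 1 then 0 else if v = 2 then 1 else x (v - 2))"

lemma minor_eq_difference:
  assumes "(i, j) \<in> S_index n"
  shows "minor n x i j = positions n x j - positions n x i"
  using assms by (auto simp: minor_def X_matrix_def positions_def S_index_def)

lemma positions_upd:
  assumes "n \<ge> 4" "k \<in> {1..n-3}"
  shows "positions n (x(k := t)) = (positions n x)(k + 2 := t)"
  using assms by (auto simp: positions_def fun_eq_iff)

lemma deriv_minor:
  assumes "n \<ge> 4" "k \<in> {1..n-3}" "(i, j) \<in> S_index n"
  shows "deriv (\<lambda>t. minor n (x(k := t)) i j) a = of_bool (j = k + 2) - of_bool (i = k + 2)"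
proof -
  have "((\<lambda>t. minor n (x(k := t)) i j) has_field_derivative
      (of_bool (j = k + 2) - of_bool (i = k + 2))) (at a)"
    unfolding minor_eq_difference[OF assms(3)] positions_upd[OF assms(1,2)]
    by (auto intro!: derivative_eq_intros)
  then show ?thesis by (rule DERIV_imp_deriv)
qed

lemma force_insert_base:
  assumes "v \<notin> {1, 2}" "finite T"
  shows "force (insert (1, 2) T) w y v = force T w y v"
  using assms by (cases "(1, 2) \<in> T") (auto simp: force_def insert_absorb)

lemma S_index_finite: "finite (S_index n)"
  by (rule finite_subset[of _ "{..n} \<times> {..n}"]) (auto simp: S_index_def)

lemma critical_point_iff_equilibrium:
  assumes n: "n \<ge> 4" and T: "T \<subseteq> S_index n"
  shows "critical_point n T s x \<longleftrightarrow>
    x \<in> points n \<and> equilibrium {1..n-1} (insert (1, 2) T) s (positions n x)"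
proof -
  let ?y = "positions n x"
  have base: "?y 1 = 0" "?y 2 = 1"
    using n by (auto simp: positions_def)
  have fin: "finite T"
    using T S_index_finite finite_subset by blast
  have nz: "(\<forall>(i, j)\<in>T. minor n x i j \<noteq> 0) \<longleftrightarrow> (\<forall>(i, j)\<in>insert (1, 2) T. ?y i \<noteq> ?y j)"
    using T base by (fastforce simp: minor_eq_difference)
  have eq: "(\<Sum>(i, j)\<in>T. s (i, j) * deriv (\<lambda>t. minor n (x(k := t)) i j) (x k) / minor n x i j)
      = force (insert (1, 2) T) s ?y (k + 2)" if "k \<in> {1..n-3}" for k
  proof -
    have "(\<Sum>(i, j)\<in>T. s (i, j) * deriv (\<lambda>t. minor n (x(k := t)) i j) (x k) / minor n x i j)
      = force T s ?y (k + 2)"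
      unfolding force_def
      using T deriv_minor[OF n that] minor_eq_difference by (intro sum.cong) auto
    also have "\<dots> = force (insert (1, 2) T) s ?y (k + 2)"
      using that fin by (intro force_insert_base[symmetric]) auto
    finally show ?thesis .
  qed
  have im: "(+) 2 ` {1..n-3} = {1..n-1} - {1, 2}"
  proof (intro equalityI subsetI)
    fix v assume "v \<in> {1..n-1} - {1, 2}"
    then have "v = 2 + (v - 2)" "v - 2 \<in> {1..n-3}" by auto
    then show "v \<in> (+) 2 ` {1..n-3}" by (rule image_eqI)
  qed (use n in auto)
  have "(\<forall>v\<in>{1..n-1} - {1, 2}. force (insert (1, 2) T) s ?y v = 0) \<longleftrightarrow>
      (\<forall>k\<in>{1..n-3}. force (insert (1, 2) T) s ?y (k + 2) = 0)"
    unfolding im[symmetric] by (simp add: add.commute)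
  then show ?thesis
    unfolding critical_point_iff equilibrium_def nz using base eq by simp
qed

lemma one_critical_point_iff:
  assumes n: "n \<ge> 4" and T: "T \<subseteq> S_index n"
  shows "(\<exists>!x. critical_point n T s x) \<longleftrightarrow>
    unique_equilibrium {1..n-1} (insert (1, 2) T) s"
proof -
  have inj: "inj_on (positions n) (points n)"
  proof (rule inj_onI)
    fix x x' assume x: "x \<in> points n" "x' \<in> points n" and e: "positions n x = positions n x'"
    have "x k = x' k" if "k \<in> {1..n-3}" for k
      using that n fun_cong[OF e, of "k + 2"] by (auto simp: positions_def split: if_splits)
    with x show "x = x'"
      unfolding points_def by (rule PiE_ext)
  qed
  have surj: "\<exists>x\<in>points n. positions n x = y"
    if "y \<in> extensional {1..n-1}" "y 1 = 0" "y 2 = 1" for y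
  proof
    show "(\<lambda>k\<in>{1..n-3}. y (k + 2)) \<in> points n" by (simp add: points_def)
    show "positions n (\<lambda>k\<in>{1..n-3}. y (k + 2)) = y"
    proof
      fix v :: nat
      have "v = v - 2 + 2" if "v \<notin> {0, 1}"
        using that by (cases v) auto
      then show "positions n (\<lambda>k\<in>{1..n-3}. y (k + 2)) v = y v"
        using that n by (auto simp: positions_def extensional_def)
    qed
  qed
  have ext: "positions n x \<in> extensional {1..n-1}" for x
    by (simp add: positions_def)
  let ?P = "equilibrium {1..n-1} (insert (1, 2) T) s"
  show ?thesis
    unfolding unique_equilibrium_def critical_point_iff_equilibrium[OF n T]
  proof
    assume "\<exists>!x. x \<in> points n \<and> ?P (positions n x)"
    then obtain x where x: "x \<in> points n" "?P (positions n x)"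
      and u: "\<And>x'. x' \<in> points n \<Longrightarrow> ?P (positions n x') \<Longrightarrow> x' = x" by blast
    show "\<exists>!y. y \<in> extensional {1..n-1} \<and> ?P y"
    proof (rule ex1I[of _ "positions n x"])
      show "positions n x \<in> extensional {1..n-1} \<and> ?P (positions n x)" using x ext by blast
      fix y assume y: "y \<in> extensional {1..n-1} \<and> ?P y"
      then have "y 1 = 0" "y 2 = 1" unfolding equilibrium_def by blast+
      then obtain x' where x': "x' \<in> points n" "positions n x' = y" using surj y by blast
      have "x' = x" by (rule u) (use x' y in blast)+
      then show "y = positions n x" using x' by blast
    qed
  next
    assume "\<exists>!y. y \<in> extensional {1..n-1} \<and> ?P y"
    then obtain y where y: "y \<in> extensional {1..n-1}" "?P y"
      and u: "\<And>y'. y' \<in> extensional {1..n-1} \<Longrightarrow> ?P y' \<Longrightarrow> y' = y" by blast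
    then have "y 1 = 0" "y 2 = 1" unfolding equilibrium_def by blast+
    then obtain x where x: "x \<in> points n" "positions n x = y" using surj y by blast
    show "\<exists>!x. x \<in> points n \<and> ?P (positions n x)"
    proof (rule ex1I[of _ x])
      show "x \<in> points n \<and> ?P (positions n x)" using x y by blast
      fix x' assume x': "x' \<in> points n \<and> ?P (positions n x')"
      then have "positions n x' = positions n x" using u ext x by blast
      then show "x' = x" using inj x x' unfolding inj_on_def by blast
    qed
  qed
qed


section \<open>2-trees have one critical point\<close>

lemma two_tree_based_graph: "two_tree V E \<Longrightarrow> based_graph V E"
proof (induction rule: two_tree.induct)
  case single_edge
  then show ?case by (simp add: based_graph_def)
next
  case (attach V E i j k)
  then have "i \<in> V" "j \<in> V" "i \<noteq> k" "j \<noteq> k" by (auto simp: based_graph_def)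
  then show ?case
    using attach by (auto simp: based_graph_def edge_def min_def max_def)
qed

lemma force_insert_edge:
  assumes "finite E" "edge a b \<notin> E" "a \<noteq> b"
  shows "force (insert (edge a b) E) w y v =
    w (edge a b) * (of_bool (b = v) - of_bool (a = v)) / (y b - y a) + force E w y v"
proof -
  have "(of_bool (b = v) - of_bool (a = v)) / (y b - y a) =
      (of_bool (a = v) - of_bool (b = v)) / (y a - y b)"
    by (metis minus_diff_eq minus_divide_divide)
  then show ?thesis
    using assms by (cases "a < b") (auto simp: force_def edge_def min_def max_def simp flip: times_divide_eq_right)
qed

lemma force_add_weight:
  assumes "finite E" "(i, j) \<in> E"
  shows "force E (w((i, j) := w (i, j) + c)) y v =
    force E w y v + c * (of_bool (j = v) - of_bool (i = v)) / (y j - y i)"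
proof -
  have split: "force E u y v = u (i, j) * (of_bool (j = v) - of_bool (i = v)) / (y j - y i)
      + force (E - {(i, j)}) u y v" for u
    unfolding force_def sum.remove[OF assms] by simp
  have "force (E - {(i, j)}) (w((i, j) := w (i, j) + c)) y v = force (E - {(i, j)}) w y v"
    unfolding force_def by (intro sum.cong) (auto split: if_splits)
  then show ?thesis
    unfolding split by (simp add: distrib_right add_divide_distrib)
qed

lemma equilibrium_cong:
  assumes "based_graph V E" "\<And>v. v \<in> V \<Longrightarrow> y v = z v"
  shows "equilibrium V E w y \<longleftrightarrow> equilibrium V E w z"
proof -
  have "force E w y v = force E w z v" for v
    unfolding force_def using assms by (intro sum.cong) (auto simp: based_graph_def)
  moreover have "(\<forall>(i, j)\<in>E. y i \<noteq> y j) \<longleftrightarrow> (\<forall>(i, j)\<in>E. z i \<noteq> z j)"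
    using assms by (intro ball_cong) (auto simp: based_graph_def)
  moreover have "y 1 = z 1" "y 2 = z 2" using assms by (auto simp: based_graph_def)
  ultimately show ?thesis by (simp add: equilibrium_def)
qed

text \<open>
  The balance of a vertex at \<open>r\<close> with neighbours at \<open>p\<close> and \<open>q\<close> is a linear equation for \<open>r\<close>; its solution
  avoids \<open>p\<close> and \<open>q\<close> because \<open>r - p\<close> and \<open>r - q\<close> are nonzero multiples of \<open>q - p\<close>.
\<close>

lemma series_balance:
  fixes a b p q r :: "'a::field"
  assumes "a \<noteq> 0" "b \<noteq> 0" "a + b \<noteq> 0" "p \<noteq> q"
  shows "r \<noteq> p \<and> r \<noteq> q \<and> a / (r - p) + b / (r - q) = 0 \<longleftrightarrow> r = (a * q + b * p) / (a + b)"
    (is "?L \<longleftrightarrow> ?R")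
proof
  assume L: ?L
  then have "(a * (r - q) + b * (r - p)) / ((r - p) * (r - q)) = 0"
    using add_frac_eq[of "r - p" "r - q" a b] by simp
  then have "a * (r - q) + b * (r - p) = 0" using L by simp
  then have "r * (a + b) = a * q + b * p" by (simp add: algebra_simps)
  then show ?R using assms by (simp add: eq_divide_eq)
next
  assume r: ?R
  have rp: "r - p = a * (q - p) / (a + b)" and rq: "r - q = b * (p - q) / (a + b)"
    using assms by (simp_all add: r field_simps)
  then have nz: "r - p \<noteq> 0" "r - q \<noteq> 0" using assms by auto
  moreover have "a / (r - p) = (a + b) / (q - p)" "b / (r - q) = (a + b) / (p - q)"
    using assms by (simp_all add: rp rq)
  moreover have "(a + b) / (q - p) + (a + b) / (p - q) = 0"
    using assms by (simp add: field_simps)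
  ultimately show ?L by auto
qed

text \<open>
  Seen from \<open>p\<close> and \<open>q\<close>, a balanced vertex at \<open>r\<close> exerts the force of an edge of weight \<open>a + b\<close>
  between \<open>p\<close> and \<open>q\<close>.
\<close>

lemma series_force:
  fixes a b p q r :: "'a::field"
  assumes "a \<noteq> 0" "b \<noteq> 0" "a + b \<noteq> 0" "p \<noteq> q" "r = (a * q + b * p) / (a + b)"
  shows "a / (r - p) = (a + b) / (q - p)" "b / (r - q) = (a + b) / (p - q)"
proof -
  have rp: "r - p = a * (q - p) / (a + b)" and rq: "r - q = b * (p - q) / (a + b)"
    using assms by (simp_all add: field_simps)
  then show "a / (r - p) = (a + b) / (q - p)" "b / (r - q) = (a + b) / (p - q)"
    using assms by simp_all
qed

text \<open>
  The series reduction: the attached vertex can be eliminated at the price of adding the weights of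
  its two edges to the edge that it was attached to.
\<close>

lemma equilibrium_attach_iff:
  fixes w :: "nat \<times> nat \<Rightarrow> 'a::field"
  assumes G: "based_graph V E" and ij: "(i, j) \<in> E" and k: "k \<notin> V"
    and a: "a = w (edge i k)" "a \<noteq> 0" and b: "b = w (edge j k)" "b \<noteq> 0" and ab: "a + b \<noteq> 0"
  shows "equilibrium (insert k V) (E \<union> {edge i k, edge j k}) w y \<longleftrightarrow>
    y k = (a * y j + b * y i) / (a + b) \<and> equilibrium V E (w((i, j) := w (i, j) + (a + b))) y"
proof -
  let ?E = "insert (edge i k) (insert (edge j k) E)"
  let ?w = "w((i, j) := w (i, j) + (a + b))"
  let ?d = "\<lambda>v x. of_bool (x = v) :: 'a"
  have fin: "finite E" using G by (rule based_graph_finite)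
  have V: "i \<in> V" "j \<in> V" "i < j" "k \<noteq> 1" "k \<noteq> 2" "i \<noteq> k" "j \<noteq> k"
    using G ij k by (auto simp: based_graph_def)
  have new: "edge j k \<notin> E" "edge i k \<notin> insert (edge j k) E"
    using G k V by (auto simp: based_graph_def edge_def min_def max_def split: if_splits)
  have F: "force ?E w y v = a * (?d v k - ?d v i) / (y k - y i) + b * (?d v k - ?d v j) / (y k - y j)
      + force E w y v" for v
    using force_insert_edge[OF _ new(2) \<open>i \<noteq> k\<close>, of w y v] force_insert_edge[OF fin new(1) \<open>j \<noteq> k\<close>, of w y v]
      fin a(1) b(1) by simp
  have Fk: "force E w y k = 0"
    unfolding force_def using G k by (intro sum.neutral) (auto simp: based_graph_def)
  have neq: "(\<forall>(s, t)\<in>?E. y s \<noteq> y t) \<longleftrightarrow> y k \<noteq> y i \<and> y k \<noteq> y j \<and> (\<forall>(s, t)\<in>E. y s \<noteq> y t)"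
    by (auto simp: edge_def min_def max_def)
  have kk: "force ?E w y k = a / (y k - y i) + b / (y k - y j)"
    using F[of k] Fk V by simp
  have vv: "force ?E w y v = force E ?w y v"
    if "v \<in> V" "y i \<noteq> y j" and yk: "y k = (a * y j + b * y i) / (a + b)" for v
  proof -
    have "v \<noteq> k" using that k by auto
    have s: "a / (y k - y i) = (a + b) / (y j - y i)" "b / (y k - y j) = (a + b) / (y i - y j)"
      by (rule series_force[OF a(2) b(2) ab that(2) yk])+
    define D where "D = (a + b) / (y j - y i)"
    have D: "a / (y k - y i) = D" "b / (y k - y j) = - D"
      unfolding s D_def by (metis minus_diff_eq minus_divide_right)+
    have "force ?E w y v = - ?d v i * (a / (y k - y i)) - ?d v j * (b / (y k - y j)) + force E w y v"
      using F[of v] \<open>v \<noteq> k\<close> by simp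
    also have "\<dots> = (?d v j - ?d v i) * D + force E w y v"
      unfolding D by (simp add: algebra_simps)
    also have "(?d v j - ?d v i) * D = (a + b) * (?d v j - ?d v i) / (y j - y i)"
      unfolding D_def by simp
    finally show ?thesis
      using force_add_weight[OF fin ij, of w "a + b" y v] by simp
  qed
  have "equilibrium (insert k V) ?E w y \<longleftrightarrow> y 1 = 0 \<and> y 2 = 1 \<and> (\<forall>(s, t)\<in>E. y s \<noteq> y t) \<and>
      (y k \<noteq> y i \<and> y k \<noteq> y j \<and> a / (y k - y i) + b / (y k - y j) = 0) \<and>
      (\<forall>v\<in>V - {1, 2}. force ?E w y v = 0)"
    unfolding equilibrium_def neq using V kk by auto
  also have "\<dots> \<longleftrightarrow> y k = (a * y j + b * y i) / (a + b) \<and> equilibrium V E ?w y"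
  proof (cases "\<forall>(s, t)\<in>E. y s \<noteq> y t")
    case True
    then have yij: "y i \<noteq> y j" using ij by auto
    show ?thesis
      unfolding equilibrium_def series_balance[OF a(2) b(2) ab yij]
      using vv[OF _ yij] by auto
  qed (auto simp: equilibrium_def)
  finally show ?thesis by (simp add: insert_commute)
qed

lemma unique_equilibrium_attach:
  assumes G: "based_graph V E" and ij: "(i, j) \<in> E" and k: "k \<notin> V"
    and a: "a = w (edge i k)" "a \<noteq> 0" and b: "b = w (edge j k)" "b \<noteq> 0" and ab: "a + b \<noteq> 0"
    and u: "unique_equilibrium V E (w((i, j) := w (i, j) + (a + b)))"
  shows "unique_equilibrium (insert k V) (E \<union> {edge i k, edge j k}) w"
proof -
  let ?w = "w((i, j) := w (i, j) + (a + b))"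
  note iff = equilibrium_attach_iff[where w = w, OF G ij k a b ab]
  have ijk: "i \<noteq> k" "j \<noteq> k" using G ij k by (auto simp: based_graph_def)
  from u obtain y where y: "y \<in> extensional V" "equilibrium V E ?w y"
    and only: "\<And>z. z \<in> extensional V \<Longrightarrow> equilibrium V E ?w z \<Longrightarrow> z = y"
    unfolding unique_equilibrium_def by blast
  let ?y = "y(k := (a * y j + b * y i) / (a + b))"
  have "equilibrium V E ?w ?y \<longleftrightarrow> equilibrium V E ?w y"
    by (rule equilibrium_cong[OF G]) (use k in auto)
  then have "equilibrium V E ?w ?y" using y(2) by blast
  then have "equilibrium (insert k V) (E \<union> {edge i k, edge j k}) w ?y"
    unfolding iff using ijk by simp
  moreover have "?y \<in> extensional (insert k V)"
    using y(1) by (auto simp: extensional_def)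
  moreover have "z = ?y" if z: "z \<in> extensional (insert k V)"
    "equilibrium (insert k V) (E \<union> {edge i k, edge j k}) w z" for z
  proof -
    from z(2) have zk: "z k = (a * z j + b * z i) / (a + b)" and zV: "equilibrium V E ?w z"
      unfolding iff by auto
    have "equilibrium V E ?w (restrict z V) \<longleftrightarrow> equilibrium V E ?w z"
      by (rule equilibrium_cong[OF G]) simp
    with zV have "equilibrium V E ?w (restrict z V)" by blast
    then have e: "restrict z V = y" by (intro only) auto
    have V: "z v = y v" if "v \<in> V" for v
      using that fun_cong[OF e, of v] by simp
    have "i \<in> V" "j \<in> V" using G ij by (auto simp: based_graph_def)
    with zk have "z k = ?y k" by (simp add: V)
    moreover have "z v = ?y v" if "v \<noteq> k" for v
      using that V z(1) y(1) by (cases "v \<in> V") (auto simp: extensional_def)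
    ultimately show "z = ?y" by (metis ext)
  qed
  ultimately show ?thesis unfolding unique_equilibrium_def by blast
qed

lemma polynomial_functions_compose:
  assumes "f \<in> polynomial_functions I" "\<And>i. i \<in> I \<Longrightarrow> (\<lambda>s. g s i) \<in> polynomial_functions J"
  shows "(\<lambda>s. f (g s)) \<in> polynomial_functions J"
  using assms(1)
  by (induction rule: polynomial_functions.induct)
    (auto intro: polynomial_functions.intros assms(2))

text \<open>
  The polynomial is built along the construction of the 2-tree: each attachment multiplies by \<open>a\<close>, \<open>b\<close> and
  \<open>a + b\<close> and substitutes the reduced weight of the edge. It does not vanish at positive weights since the
  substitution keeps weights positive; this is what makes it a nonzero polynomial in the induction.
\<close>

lemma two_tree_generic_equilibrium:
  assumes "two_tree V E"
  shows "\<exists>P\<in>polynomial_functions E.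
    (\<forall>w. (\<forall>e. 0 < w e) \<longrightarrow> P (\<lambda>e. of_nat (w e)) \<noteq> 0) \<and>
    (\<forall>w. P w \<noteq> 0 \<longrightarrow> unique_equilibrium V E w)"
  using assms
proof (induction rule: two_tree.induct)
  case single_edge
  have "unique_equilibrium {1, 2} {(1, 2)} w" for w
    unfolding unique_equilibrium_def
  proof (rule ex1I[of _ "\<lambda>v\<in>{1, 2}. of_bool (v = 2)"])
    fix y assume "y \<in> extensional {1, 2} \<and> equilibrium {1, 2} {(1, 2)} w y"
    then show "y = (\<lambda>v\<in>{1, 2}. of_bool (v = 2))"
      by (auto simp: equilibrium_def extensional_def)
  qed (simp add: equilibrium_def)
  then show ?case
    by (intro bexI[of _ "\<lambda>_. 1"]) (auto intro: polynomial_functions.const)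
next
  case (attach V E i j k)
  then obtain P where P: "P \<in> polynomial_functions E"
    "\<And>w. (\<And>e. 0 < w e) \<Longrightarrow> P (\<lambda>e. of_nat (w e)) \<noteq> 0"
    "\<And>w. P w \<noteq> 0 \<Longrightarrow> unique_equilibrium V E w" by blast
  have G: "based_graph V E" by (rule two_tree_based_graph) fact
  let ?E = "E \<union> {edge i k, edge j k}"
  let ?c = "\<lambda>w :: nat \<times> nat \<Rightarrow> complex. w (edge i k) + w (edge j k)"
  let ?g = "\<lambda>w. w((i, j) := w (i, j) + ?c w)"
  let ?Q = "\<lambda>w. w (edge i k) * w (edge j k) * ?c w * P (?g w)"
  show ?case
  proof (intro bexI conjI allI impI)
    have "(\<lambda>w. ?g w e) \<in> polynomial_functions ?E" if "e \<in> E" for e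
      using that attach.hyps(2)
      by (cases "e = (i, j)") (auto intro!: polynomial_functions.add polynomial_functions.var)
    from polynomial_functions_compose[OF P(1) this]
    have "(\<lambda>w. P (?g w)) \<in> polynomial_functions ?E" .
    then show "?Q \<in> polynomial_functions ?E"
      by (intro polynomial_functions.mult polynomial_functions.add polynomial_functions.var) auto
  next
    fix w :: "nat \<times> nat \<Rightarrow> nat" assume w: "\<forall>e. 0 < w e"
    let ?v = "w((i, j) := w (i, j) + (w (edge i k) + w (edge j k)))"
    have "P (\<lambda>e. of_nat (?v e)) \<noteq> 0"
    proof (rule P(2))
      fix e show "0 < ?v e" using w[rule_format, of e] by (cases "e = (i, j)") auto
    qed
    moreover have "(\<lambda>e. of_nat (?v e)) = ?g (\<lambda>e. of_nat (w e))" by auto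
    moreover have "?c (\<lambda>e. of_nat (w e)) \<noteq> 0"
      using w by (metis add_is_0 of_nat_add of_nat_eq_0_iff less_numeral_extra(3))
    ultimately show "?Q (\<lambda>e. of_nat (w e)) \<noteq> 0"
      using w[rule_format, of "edge i k"] w[rule_format, of "edge j k"] by simp
  next
    fix w assume "?Q w \<noteq> 0"
    then show "unique_equilibrium (insert k V) ?E w"
      using attach.hyps by (intro unique_equilibrium_attach[OF G _ _ refl _ refl] P(3)) auto
  qed
qed


section \<open>Bipolar labellings\<close>

definition neighbors :: "(nat \<times> nat) set \<Rightarrow> nat \<Rightarrow> nat set" where
  "neighbors E v = {u. (u, v) \<in> E \<or> (v, u) \<in> E}"

text \<open>
  Orienting the edges from smaller to larger values gives an acyclic orientation in which 1 is the only
  source and 2 is the only sink, and all such orientations of a finite graph arise so. In graph theory they are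
  called bipolar orientations or st-orientations.
\<close>

definition bipolar :: "nat set \<Rightarrow> (nat \<times> nat) set \<Rightarrow> (nat \<Rightarrow> real) \<Rightarrow> bool" where
  "bipolar V E y \<longleftrightarrow> y 1 = 0 \<and> y 2 = 1 \<and> (\<forall>(i, j)\<in>E. y i \<noteq> y j) \<and>
     (\<forall>v\<in>V - {1, 2}. (\<exists>u\<in>neighbors E v. y u < y v) \<and> (\<exists>u\<in>neighbors E v. y v < y u))"

definition same_orientation :: "(nat \<times> nat) set \<Rightarrow> (nat \<Rightarrow> real) \<Rightarrow> (nat \<Rightarrow> real) \<Rightarrow> bool" where
  "same_orientation E y z \<longleftrightarrow> (\<forall>(i, j)\<in>E. y i < y j \<longleftrightarrow> z i < z j)"

lemma neighbors_sym: "u \<in> neighbors E v \<longleftrightarrow> v \<in> neighbors E u"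
  by (auto simp: neighbors_def)

lemma neighbors_subset: "based_graph V E \<Longrightarrow> neighbors E v \<subseteq> V"
  by (auto simp: neighbors_def based_graph_def)

lemma bipolar_neq: "bipolar V E y \<Longrightarrow> u \<in> neighbors E v \<Longrightarrow> y u \<noteq> y v"
  by (fastforce simp: neighbors_def bipolar_def)

lemma bipolar_lower: "bipolar V E y \<Longrightarrow> v \<in> V - {1, 2} \<Longrightarrow> \<exists>u\<in>neighbors E v. y u < y v"
  by (simp add: bipolar_def)

lemma bipolar_upper: "bipolar V E y \<Longrightarrow> v \<in> V - {1, 2} \<Longrightarrow> \<exists>u\<in>neighbors E v. y v < y u"
  by (simp add: bipolar_def)

lemma finite_lowest:
  fixes y :: "'a \<Rightarrow> real"
  assumes "finite A" "A \<noteq> {}"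
  shows "\<exists>a\<in>A. \<forall>b\<in>A. y a \<le> y b"
  using ex_is_arg_min_if_finite[OF assms, of y] by (auto simp: is_arg_min_linorder)

lemma finite_highest:
  fixes y :: "'a \<Rightarrow> real"
  assumes "finite A" "A \<noteq> {}"
  shows "\<exists>a\<in>A. \<forall>b\<in>A. y b \<le> y a"
  using finite_lowest[OF assms, of "\<lambda>a. - y a"] by simp

lemma bipolar_bounds:
  assumes G: "based_graph V E" and y: "bipolar V E y" and v: "v \<in> V - {1, 2}"
  shows "0 < y v" "y v < 1"
proof -
  have fin: "finite V" and V: "V \<noteq> {}" using G by (auto simp: based_graph_def)
  obtain a where a: "a \<in> V" "\<forall>u\<in>V. y a \<le> y u"
    using finite_lowest[OF fin V] by blast
  have "a \<in> {1, 2}"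
  proof (rule ccontr)
    assume "a \<notin> {1, 2}"
    then obtain u where "u \<in> neighbors E a" "y u < y a"
      using bipolar_lower[OF y, of a] a by blast
    then show False using a neighbors_subset[OF G] by force
  qed
  then have lo: "\<forall>u\<in>V. 0 \<le> y u"
    using a y by (auto simp: bipolar_def)
  obtain b where b: "b \<in> V" "\<forall>u\<in>V. y u \<le> y b"
    using finite_highest[OF fin V] by blast
  have "b \<in> {1, 2}"
  proof (rule ccontr)
    assume "b \<notin> {1, 2}"
    then obtain u where "u \<in> neighbors E b" "y b < y u"
      using bipolar_upper[OF y, of b] b by blast
    then show False using b neighbors_subset[OF G] by force
  qed
  then have hi: "\<forall>u\<in>V. y u \<le> 1"
    using b y by (auto simp: bipolar_def)
  obtain u u' where "u \<in> neighbors E v" "y u < y v" "u' \<in> neighbors E v" "y v < y u'"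
    using bipolar_lower[OF y v] bipolar_upper[OF y v] by blast
  then show "0 < y v" "y v < 1"
    using lo hi neighbors_subset[OF G] by force+
qed

text \<open>
  Reversing the edge \<open>uv\<close> creates no cycle because \<open>v\<close> has no lower neighbour above \<open>u\<close>, and it keeps the
  labelling bipolar because \<open>v\<close> retains the lower neighbour \<open>v2\<close> and \<open>u\<close> the upper neighbour \<open>u2\<close>.
\<close>

lemma swap_gives_other_orientation:
  assumes G: "based_graph V E" and y: "bipolar V E y"
    and u: "u \<in> V - {1, 2}" and v: "v \<in> V - {1, 2}" and uv: "u \<in> neighbors E v" "y u < y v"
    and highest: "\<And>a. a \<in> neighbors E v \<Longrightarrow> y a < y v \<Longrightarrow> y a \<le> y u"
    and v2: "v2 \<in> neighbors E v" "y v2 < y v" "v2 \<noteq> u"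
    and u2: "u2 \<in> neighbors E u" "y u < y u2" "u2 \<noteq> v"
  shows "\<exists>z. bipolar V E z \<and> \<not> same_orientation E y z"
proof -
  define A where "A = {z \<in> V. y u < y z}"
  define c where "c = Min (y ` A)"
  have A: "finite (y ` A)" "y ` A \<noteq> {}"
    using G u v uv by (auto simp: A_def based_graph_def)
  have "c \<in> y ` A" unfolding c_def using A by (rule Min_in)
  then have cu: "y u < c" by (auto simp: A_def)
  have cz: "c \<le> y z" if "z \<in> V" "y u < y z" for z
    unfolding c_def using A that by (intro Min_le) (auto simp: A_def)
  \<comment> \<open>\<open>c\<close> is the lowest value above \<open>y u\<close>, so \<open>v\<close> and \<open>u\<close>, placed at \<open>y u + e\<close> and \<open>y u + 2 * e\<close>,
    exchange their order without passing any other vertex above \<open>u\<close>. Lower neighbours of \<open>v\<close> that tie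
    with \<open>u\<close> remain below \<open>v\<close>.\<close>
  define e where "e = (c - y u) / 3"
  have e: "0 < e" "y u + 2 * e < c" using cu by (auto simp: e_def field_simps)
  define z where "z = y(v := y u + e, u := y u + 2 * e)"
  have zu: "z u = y u + 2 * e" and zv: "z v = y u + e" and zo: "\<And>a. a \<noteq> u \<Longrightarrow> a \<noteq> v \<Longrightarrow> z a = y a"
    using uv by (auto simp: z_def)
  have above: "y u + 2 * e < y a" if "a \<in> V" "y u < y a" for a
    using cz[OF that] e by linarith
  have mono: "z a < z b" if ab: "a \<in> neighbors E b" "y a < y b" "(a, b) \<noteq> (u, v)" for a b
  proof -
    have V: "a \<in> V" "b \<in> V"
      using ab neighbors_subset[OF G] neighbors_sym by blast+
    consider "a = u" | "a = v" | "b = u" "a \<noteq> v" | "b = v" "a \<noteq> u" | "a \<notin> {u, v}" "b \<notin> {u, v}"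
      by blast
    then show ?thesis
    proof cases
      case 1
      then have "b \<noteq> u" "b \<noteq> v" using ab by auto
      then show ?thesis using 1 zu zo above[of b] ab V by simp
    next
      case 2
      then have "b \<noteq> u" "b \<noteq> v" using ab uv by auto
      then show ?thesis using 2 zv zo above[of b] ab V uv e by simp
    next
      case 3
      then show ?thesis using ab zu zo[of a] e by (cases "a = u") auto
    next
      case 4
      then show ?thesis using ab zv zo[of a] e highest[of a] by (cases "a = v") auto
    next
      case 5
      then show ?thesis using zo ab by simp
    qed
  qed
  have flipped: "z v < z u" using zu zv e by simp
  have "bipolar V E z"
    unfolding bipolar_def
  proof (intro conjI ballI)
    show "z 1 = 0" "z 2 = 1" using y u v zo[of 1] zo[of 2] by (auto simp: bipolar_def)
  next
    fix p assume p: "p \<in> E"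
    obtain i j where ij: "p = (i, j)" by (cases p)
    then have n: "i \<in> neighbors E j" "j \<in> neighbors E i" using p by (auto simp: neighbors_def)
    have "y i \<noteq> y j" using bipolar_neq[OF y n(1)] .
    then consider "y i < y j" | "y j < y i" by linarith
    then have "z i \<noteq> z j"
    proof cases
      case 1
      then show ?thesis using mono[OF n(1)] flipped by (cases "(i, j) = (u, v)") auto
    next
      case 2
      then show ?thesis using mono[OF n(2)] flipped by (cases "(j, i) = (u, v)") auto
    qed
    then show "case p of (i, j) \<Rightarrow> z i \<noteq> z j" by (simp add: ij)
  next
    fix x assume x: "x \<in> V - {1, 2}"
    obtain a where a: "a \<in> neighbors E x" "y a < y x" using bipolar_lower[OF y x] by blast
    obtain b where b: "b \<in> neighbors E x" "y x < y b" using bipolar_upper[OF y x] by blast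
    show "\<exists>w\<in>neighbors E x. z w < z x"
    proof (cases "x = v")
      case True
      then show ?thesis using mono[OF v2(1,2)] v2 by auto
    next
      case False
      then show ?thesis using mono[OF a] a by auto
    qed
    show "\<exists>w\<in>neighbors E x. z x < z w"
    proof (cases "x = u")
      case True
      have "u \<in> neighbors E u2" using u2(1) neighbors_sym by blast
      then show ?thesis using True mono[of u u2] u2 by auto
    next
      case False
      have "x \<in> neighbors E b" using b(1) neighbors_sym by blast
      then show ?thesis using False mono[of x b] b by auto
    qed
  qed
  moreover have "\<not> same_orientation E y z"
    using uv flipped by (fastforce simp: same_orientation_def neighbors_def)
  ultimately show ?thesis by blast
qed

text \<open>
  Call the vertices other than 1 and 2 inner. If each of them had two neighbours on at least one side,
  then every inner vertex outside \<open>B\<close>, the set of inner vertices with two lower neighbours, would have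
  two upper neighbours. The topmost inner vertex has 2 as its only upper neighbour, so \<open>B\<close> is not empty. The highest lower neighbour \<open>u\<close> of the lowest
  \<open>v\<close> in \<open>B\<close> lies below \<open>v\<close>, hence outside \<open>B\<close>, and the edge \<open>uv\<close> can be reversed.
\<close>

lemma unique_orientation_series_vertex:
  assumes G: "based_graph V E" and y: "bipolar V E y" and V: "V \<noteq> {1, 2}"
    and unique: "\<And>z. bipolar V E z \<Longrightarrow> same_orientation E y z"
  obtains k i j where "k \<in> V - {1, 2}" "neighbors E k = {i, j}" "y i < y k" "y k < y j"
proof -
  define low where "low v = {u \<in> neighbors E v. y u < y v}" for v
  define up where "up v = {u \<in> neighbors E v. y v < y u}" for v
  define B where "B = {v \<in> V - {1, 2}. \<exists>a\<in>low v. \<exists>b\<in>low v. a \<noteq> b}"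
  have inner: "0 < y v" "y v < 1" if "v \<in> V - {1, 2}" for v
    using bipolar_bounds[OF G y that] by auto
  have ends: "y 1 = 0" "y 2 = 1" using y by (auto simp: bipolar_def)
  have fin: "finite V" "{1, 2} \<subseteq> V" using G by (auto simp: based_graph_def)
  have "\<exists>k\<in>V - {1, 2}. k \<notin> B \<and> (\<forall>a\<in>up k. \<forall>b\<in>up k. a = b)"
  proof (rule ccontr)
    assume "\<not> ?thesis"
    then have two_up: "\<exists>a\<in>up v. \<exists>b\<in>up v. a \<noteq> b" if "v \<in> V - {1, 2}" "v \<notin> B" for v
      using that by blast
    have "\<exists>t\<in>V - {1, 2}. \<forall>v\<in>V - {1, 2}. y v \<le> y t"
      using fin V by (intro finite_highest) auto
    then obtain t where t: "t \<in> V - {1, 2}" "\<forall>v\<in>V - {1, 2}. y v \<le> y t" by blast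
    have "up t \<subseteq> {2}"
    proof
      fix a assume a: "a \<in> up t"
      then have "a \<in> V" "y t < y a" using neighbors_subset[OF G] by (auto simp: up_def)
      then show "a \<in> {2}" using t ends inner(1)[OF t(1)] by force
    qed
    then have "t \<in> B" using two_up[OF t(1)] by blast
    moreover have "finite B" using fin by (auto simp: B_def)
    ultimately have "\<exists>v\<in>B. \<forall>b\<in>B. y v \<le> y b"
      by (intro finite_lowest) auto
    then obtain v where v: "v \<in> B" "\<forall>b\<in>B. y v \<le> y b" by blast
    then have vV: "v \<in> V - {1, 2}" by (auto simp: B_def)
    obtain a b where ab: "a \<in> low v" "b \<in> low v" "a \<noteq> b" using v by (auto simp: B_def)
    have lowV: "low v \<subseteq> V" using neighbors_subset[OF G] by (auto simp: low_def)
    then have "finite (low v)" using fin finite_subset by blast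
    then have "\<exists>u\<in>low v. \<forall>a\<in>low v. y a \<le> y u"
      using ab by (intro finite_highest) auto
    then obtain u where u: "u \<in> low v" "\<forall>a\<in>low v. y a \<le> y u" by blast
    obtain v2 where v2: "v2 \<in> low v" "v2 \<noteq> u" using ab by metis
    have "u \<noteq> 2" using u inner(2)[OF vV] ends by (auto simp: low_def)
    moreover have "v2 \<noteq> 2" using v2 inner(2)[OF vV] ends by (auto simp: low_def)
    moreover have "u \<noteq> 1"
    proof
      assume "u = 1"
      then have "v2 \<in> V - {1, 2}" using v2 lowV \<open>v2 \<noteq> 2\<close> by blast
      then have "0 < y v2" by (rule inner)
      moreover have "y v2 \<le> y u" using u v2 by blast
      ultimately show False using ends \<open>u = 1\<close> by simp
    qed
    ultimately have uV: "u \<in> V - {1, 2}" using u lowV by auto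
    have "u \<notin> B" using v u by (force simp: low_def)
    then obtain u2 where u2: "u2 \<in> up u" "u2 \<noteq> v" using two_up[OF uV] by metis
    have "\<exists>z. bipolar V E z \<and> \<not> same_orientation E y z"
      by (rule swap_gives_other_orientation[OF G y uV vV, of v2 u2])
        (use u v2 u2 in \<open>auto simp: low_def up_def\<close>)
    then show False using unique by blast
  qed
  then obtain k where k: "k \<in> V - {1, 2}" "k \<notin> B" "\<forall>a\<in>up k. \<forall>b\<in>up k. a = b" by blast
  obtain i where i: "i \<in> low k" using bipolar_lower[OF y k(1)] by (auto simp: low_def)
  obtain j where j: "j \<in> up k" using bipolar_upper[OF y k(1)] by (auto simp: up_def)
  have "low k = {i}" using i k by (auto simp: B_def)
  moreover have "up k = {j}" using j k(3) by auto
  moreover have "neighbors E k = low k \<union> up k"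
  proof (intro equalityI subsetI)
    fix a assume a: "a \<in> neighbors E k"
    then have "y a \<noteq> y k" by (rule bipolar_neq[OF y])
    then show "a \<in> low k \<union> up k" using a by (auto simp: low_def up_def)
  qed (auto simp: low_def up_def)
  ultimately have "neighbors E k = {i, j}" by auto
  moreover have "y i < y k" "y k < y j" using i j by (auto simp: low_def up_def)
  ultimately show ?thesis using that k(1) by blast
qed


section \<open>Graphs with one bipolar orientation are contained in 2-trees\<close>

definition suppress :: "(nat \<times> nat) set \<Rightarrow> nat \<Rightarrow> nat \<Rightarrow> nat \<Rightarrow> (nat \<times> nat) set" where
  "suppress E k i j = insert (edge i j) {(a, b)\<in>E. a \<noteq> k \<and> b \<noteq> k}"

lemma neighbors_suppress:
  assumes G: "based_graph V E" and k: "neighbors E k = {i, j}" and v: "v \<noteq> k" and ij: "i \<noteq> j"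
    "i \<noteq> k" "j \<noteq> k"
  shows "neighbors (suppress E k i j) v =
    neighbors E v - {k} \<union> (if v = i then {j} else if v = j then {i} else {})"
  using assms by (auto simp: neighbors_def suppress_def edge_def min_def max_def)

text \<open>
  Suppressing the vertex \<open>k\<close> with neighbours \<open>i\<close> and \<open>j\<close> preserves the hypotheses: labellings restrict to the
  smaller graph, and conversely a bipolar labelling of the smaller graph extends by placing \<open>k\<close> at
  the midpoint of \<open>i\<close> and \<open>j\<close>.
\<close>

lemma unique_orientation_imp_sub_two_tree:
  assumes "based_graph V E" "bipolar V E y"
    and "\<And>z. bipolar V E z \<Longrightarrow> same_orientation E y z"
  shows "\<exists>E'. two_tree V E' \<and> E \<subseteq> E'"
  using assms
proof (induction "card V" arbitrary: V E rule: less_induct)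
  case less
  note G = less.prems(1) and y = less.prems(2) and unique = less.prems(3)
  have fin: "finite V" "{1, 2} \<subseteq> V" using G by (auto simp: based_graph_def)
  show ?case
  proof (cases "V = {1, 2}")
    case True
    with G have "E \<subseteq> {(1, 2)}" by (auto simp: based_graph_def)
    then show ?thesis using True two_tree.single_edge by blast
  next
    case False
    obtain k i j where k: "k \<in> V - {1, 2}" and nk: "neighbors E k = {i, j}"
      and yk: "y i < y k" "y k < y j"
      using unique_orientation_series_vertex[OF G y False unique] by blast
    have ij: "i \<noteq> j" "i \<noteq> k" "j \<noteq> k" using yk by auto
    have ijV: "i \<in> V" "j \<in> V" using nk neighbors_subset[OF G] by blast+
    let ?V = "V - {k}" and ?E = "suppress E k i j"
    have G': "based_graph ?V ?E"
      using G k ij ijV by (auto simp: based_graph_def suppress_def edge_def min_def max_def)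
    have nb: "neighbors ?E v = neighbors E v - {k} \<union> (if v = i then {j} else if v = j then {i} else {})"
      if "v \<noteq> k" for v
      by (rule neighbors_suppress[OF G nk that ij])
    have nk': "k \<in> neighbors E v \<longleftrightarrow> v = i \<or> v = j" for v
      using nk neighbors_sym[of k E v] by auto
    have neq_suppress: "(\<forall>(a, b)\<in>?E. z a \<noteq> z b) \<longleftrightarrow>
        (\<forall>(a, b)\<in>E. a \<noteq> k \<and> b \<noteq> k \<longrightarrow> z a \<noteq> z b) \<and> z i \<noteq> z j" for z :: "nat \<Rightarrow> real"
      by (auto simp: suppress_def edge_def min_def max_def)
    have y': "bipolar ?V ?E y"
      unfolding bipolar_def neq_suppress
    proof (intro conjI)
      show "y 1 = 0" "y 2 = 1" "\<forall>(a, b)\<in>E. a \<noteq> k \<and> b \<noteq> k \<longrightarrow> y a \<noteq> y b" "y i \<noteq> y j"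
        using y yk by (auto simp: bipolar_def)
    next
      show "\<forall>v\<in>?V - {1, 2}. (\<exists>u\<in>neighbors ?E v. y u < y v) \<and> (\<exists>u\<in>neighbors ?E v. y v < y u)"
      proof (intro ballI conjI)
        fix v assume v: "v \<in> ?V - {1, 2}"
        obtain a b where a: "a \<in> neighbors E v" "y a < y v" and b: "b \<in> neighbors E v" "y v < y b"
          using bipolar_lower[OF y, of v] bipolar_upper[OF y, of v] v by blast
        have vk: "v \<noteq> k" using v by simp
        show "\<exists>u\<in>neighbors ?E v. y u < y v"
        proof (cases "a = k")
          case True
          then have "v = j" using a nk'[of v] yk by auto
          then have "i \<in> neighbors ?E v" "y i < y v" using nb[OF vk] ij yk by simp_all
          then show ?thesis by blast
        next
          case False
          then have "a \<in> neighbors ?E v" using nb[OF vk] a by simp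
          then show ?thesis using a by blast
        qed
        show "\<exists>u\<in>neighbors ?E v. y v < y u"
        proof (cases "b = k")
          case True
          then have "v = i" using b nk'[of v] yk by auto
          then have "j \<in> neighbors ?E v" "y v < y j" using nb[OF vk] ij yk by simp_all
          then show ?thesis by blast
        next
          case False
          then have "b \<in> neighbors ?E v" using nb[OF vk] b by simp
          then show ?thesis using b by blast
        qed
      qed
    qed
    have "same_orientation ?E y z" if z: "bipolar ?V ?E z" for z
    proof -
      define x where "x = z(k := (z i + z j) / 2)"
      have x: "x k = (z i + z j) / 2" "\<And>v. v \<noteq> k \<Longrightarrow> x v = z v" by (auto simp: x_def)
      have zij: "z i \<noteq> z j" and zE: "\<forall>(a, b)\<in>E. a \<noteq> k \<and> b \<noteq> k \<longrightarrow> z a \<noteq> z b"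
        using z unfolding bipolar_def neq_suppress by auto
      have "bipolar V E x"
        unfolding bipolar_def
      proof (intro conjI ballI)
        show "x 1 = 0" "x 2 = 1" using z k x(2)[of 1] x(2)[of 2] by (auto simp: bipolar_def)
      next
        fix p assume p: "p \<in> E"
        obtain a b where ab: "p = (a, b)" by (cases p)
        have "a \<noteq> b" using p ab G by (auto simp: based_graph_def)
        have "x a \<noteq> x b"
        proof (cases "a = k \<or> b = k")
          case False
          then show ?thesis using zE p ab x(2) by auto
        next
          case True
          then have "{a, b} = {k, i} \<or> {a, b} = {k, j}"
            using p ab nk \<open>a \<noteq> b\<close> by (auto simp: neighbors_def)
          moreover have "x k \<noteq> x i" "x k \<noteq> x j" using x ij zij by auto
          ultimately show ?thesis by (metis doubleton_eq_iff)
        qed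
        then show "case p of (a, b) \<Rightarrow> x a \<noteq> x b" by (simp add: ab)
      next
        fix v assume v: "v \<in> V - {1, 2}"
        show "\<exists>u\<in>neighbors E v. x u < x v"
        proof (cases "v = k")
          case True
          then show ?thesis using nk x ij zij by (cases "z i < z j") auto
        next
          case False
          obtain a where a: "a \<in> neighbors ?E v" "z a < z v"
            using bipolar_lower[OF z, of v] v False by blast
          consider "a \<in> neighbors E v" "a \<noteq> k" | "v = i" "a = j" | "v = j" "a = i"
            using a(1) nb[OF False] by (auto split: if_splits)
          then show ?thesis
          proof cases
            case 1
            then show ?thesis using a(2) x(2) False by (intro bexI[of _ a]) auto
          next
            case 2
            then have "k \<in> neighbors E v" "x k < x v" using nk' a(2) x ij by auto
            then show ?thesis by blast
          next
            case 3
            then have "k \<in> neighbors E v" "x k < x v" using nk' a(2) x ij by auto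
            then show ?thesis by blast
          qed
        qed
        show "\<exists>u\<in>neighbors E v. x v < x u"
        proof (cases "v = k")
          case True
          then show ?thesis using nk x ij zij by (cases "z i < z j") auto
        next
          case False
          obtain a where a: "a \<in> neighbors ?E v" "z v < z a"
            using bipolar_upper[OF z, of v] v False by blast
          consider "a \<in> neighbors E v" "a \<noteq> k" | "v = i" "a = j" | "v = j" "a = i"
            using a(1) nb[OF False] by (auto split: if_splits)
          then show ?thesis
          proof cases
            case 1
            then show ?thesis using a(2) x(2) False by (intro bexI[of _ a]) auto
          next
            case 2
            then have "k \<in> neighbors E v" "x v < x k" using nk' a(2) x ij by auto
            then show ?thesis by blast
          next
            case 3
            then have "k \<in> neighbors E v" "x v < x k" using nk' a(2) x ij by auto
            then show ?thesis by blast
          qed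
        qed
      qed
      then have same: "same_orientation E y x" by (rule unique)
      have "(i, k) \<in> E \<or> (k, i) \<in> E" using nk by (auto simp: neighbors_def)
      moreover have "x i \<noteq> x k" using x ij zij by auto
      ultimately have "x i < x k"
        using same yk by (fastforce simp: same_orientation_def)
      then have "z i < z j" using x ij by auto
      moreover have "y i < y j" using yk by simp
      ultimately show ?thesis
        using same x(2) by (fastforce simp: same_orientation_def suppress_def edge_def min_def max_def)
    qed
    then obtain E' where E': "two_tree ?V E'" "?E \<subseteq> E'"
      using less.hyps[OF _ G' y'] k fin by (metis DiffD1 card_Diff1_less)
    have "(i, j) \<in> E' \<or> (j, i) \<in> E'"
      using E'(2) by (auto simp: suppress_def edge_def min_def max_def split: if_splits)
    then have "two_tree (insert k ?V) (E' \<union> {edge i k, edge j k})"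
      using two_tree.attach[OF E'(1), of i j k] two_tree.attach[OF E'(1), of j i k]
      by (auto simp: insert_commute)
    moreover have "insert k ?V = V" using k by auto
    moreover have "E \<subseteq> E' \<union> {edge i k, edge j k}"
    proof
      fix p assume p: "p \<in> E"
      obtain a b where ab: "p = (a, b)" by (cases p)
      have "a < b" using p ab G by (auto simp: based_graph_def)
      show "p \<in> E' \<union> {edge i k, edge j k}"
      proof (cases "a = k \<or> b = k")
        case False
        then show ?thesis using p ab E'(2) by (auto simp: suppress_def)
      next
        case True
        then have "(a = k \<and> b \<in> {i, j}) \<or> (b = k \<and> a \<in> {i, j})"
          using p ab nk by (auto simp: neighbors_def)
        then show ?thesis using \<open>a < b\<close> ab by (auto simp: edge_def min_def max_def)
      qed
    qed
    ultimately show ?thesis by metis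
  qed
qed


section \<open>Bipolar orientations and real equilibria\<close>

text \<open>
  For positive integer weights \<open>w\<close>, \<open>F\<close> is the exponential of the potential on the region oriented as \<open>y\<close>,
  continued by zero to its boundary. The region is bounded because every inner vertex lies between its
  neighbours, so \<open>F\<close> attains its maximum; there it is positive, so the maximum lies in the open
  region, and its logarithm is critical in every coordinate.
\<close>

lemma orientation_has_equilibrium:
  fixes w :: "nat \<times> nat \<Rightarrow> nat"
  assumes G: "based_graph V E" and y: "bipolar V E y" and w: "\<And>e. e \<in> E \<Longrightarrow> 0 < w e"
  shows "\<exists>z. equilibrium V E (\<lambda>e. real (w e)) z \<and> same_orientation E y z"
proof -
  have fin: "finite E" using G by (rule based_graph_finite)
  define \<sigma> :: "nat \<times> nat \<Rightarrow> real" where "\<sigma> e = (if y (fst e) < y (snd e) then 1 else - 1)" for e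
  define g where "g z e = \<sigma> e * (z (snd e) - z (fst e))" for z :: "nat \<Rightarrow> real" and e
  define F where "F z = (\<Prod>e\<in>E. g z e ^ w e)" for z
  define K where "K = {z. z \<in> (\<Pi>\<^sub>E v\<in>UNIV. {0..1}) \<and> z 1 = 0 \<and> z 2 = 1 \<and> (\<forall>e\<in>E. 0 \<le> g z e)}"
  have cont_coord: "continuous_on UNIV (\<lambda>z :: nat \<Rightarrow> real. z v)" for v
    by (rule continuous_on_product_coordinates)
  have cont_g: "continuous_on UNIV (\<lambda>z. g z e)" for e
    unfolding g_def by (intro continuous_intros cont_coord)
  have "compact (\<Pi>\<^sub>E v\<in>(UNIV :: nat set). {0..1::real})"
    using compactin_PiE[of "\<lambda>_. euclideanreal" UNIV "\<lambda>_. {0..1}"]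
    by (simp add: euclidean_product_topology)
  moreover have "closed ({z. z 1 = 0} \<inter> {z. z 2 = 1} \<inter> (\<Inter>e\<in>E. {z. 0 \<le> g z e}))"
    by (intro closed_Int closed_INT ballI closed_Collect_eq closed_Collect_le
        cont_coord cont_g continuous_on_const)
  ultimately have "compact ((\<Pi>\<^sub>E v\<in>UNIV. {0..1}) \<inter>
      ({z. z 1 = 0} \<inter> {z. z 2 = 1} \<inter> (\<Inter>e\<in>E. {z. 0 \<le> g z e})))"
    by (rule compact_Int_closed)
  also have "\<dots> = K" unfolding K_def by blast
  finally have cpt: "compact K" .
  \<comment> \<open>\<open>K\<close> constrains the values at all natural numbers, also outside \<open>V\<close>, where \<open>y\<close> is arbitrary.\<close>
  define y0 where "y0 v = (if v \<in> V then y v else 0)" for v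
  have ends: "y 1 = 0" "y 2 = 1" "1 \<in> V" "2 \<in> V"
    using y G by (auto simp: bipolar_def based_graph_def)
  have "0 \<le> y v \<and> y v \<le> 1" if "v \<in> V" for v
    using bipolar_bounds[OF G y, of v] ends that by (cases "v \<in> {1, 2}") force+
  moreover have gy: "0 < g y0 e" if "e \<in> E" for e
    using that y G by (force simp: g_def \<sigma>_def y0_def bipolar_def based_graph_def)
  ultimately have y0: "y0 \<in> K"
    using ends by (auto simp: K_def y0_def less_imp_le)
  have "continuous_on K F"
    unfolding F_def by (intro continuous_intros continuous_on_subset[OF cont_g]) auto
  then obtain z where z: "z \<in> K" and max: "\<And>x. x \<in> K \<Longrightarrow> F x \<le> F z"
    using continuous_attains_sup[OF cpt] y0 by blast
  have "0 < F y0" unfolding F_def using gy by (intro prod_pos) auto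
  then have Fz: "0 < F z" using max[OF y0] by linarith
  have gz: "0 < g z e" if "e \<in> E" for e
  proof -
    have "g z e \<noteq> 0"
    proof
      assume "g z e = 0"
      then have "g z e ^ w e = 0" using w[OF that] by simp
      then have "F z = 0" unfolding F_def using that by (intro prod_zero[OF fin]) blast
      then show False using Fz by simp
    qed
    moreover have "0 \<le> g z e" using z that by (auto simp: K_def)
    ultimately show ?thesis by simp
  qed
  have same: "same_orientation E y z"
    unfolding same_orientation_def
  proof clarify
    fix i j assume ij: "(i, j) \<in> E"
    show "y i < y j \<longleftrightarrow> z i < z j"
      using gz[OF ij] by (auto simp: g_def \<sigma>_def split: if_splits)
  qed
  have order: "z u < z v" if uv: "u \<in> neighbors E v" "y u < y v" for u v
  proof -
    consider "(u, v) \<in> E" | "(v, u) \<in> E" using uv(1) unfolding neighbors_def by blast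
    then show ?thesis using uv(2) gz by cases (force simp: g_def \<sigma>_def)+
  qed
  have z01: "0 \<le> z v" "z v \<le> 1" for v using z by (auto simp: K_def)
  have "force E (\<lambda>e. real (w e)) z v = 0" if v: "v \<in> V - {1, 2}" for v
  proof -
    have zv: "0 < z v" "z v < 1"
    proof -
      obtain u u' where "u \<in> neighbors E v" "y u < y v" "u' \<in> neighbors E v" "y v < y u'"
        using bipolar_lower[OF y v] bipolar_upper[OF y v] by blast
      then have "z u < z v" "z v < z u'" using order neighbors_sym by blast+
      then show "0 < z v" "z v < 1" using z01(1)[of u] z01(2)[of u'] by linarith+
    qed
    let ?d = "\<lambda>e. of_bool (snd e = v) - of_bool (fst e = v) :: real"
    have dg: "((\<lambda>t. g (z(v := t)) e) has_field_derivative \<sigma> e * ?d e) (at t)" for e t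
      unfolding g_def by (auto intro!: derivative_eq_intros)
    define h where "h t = (\<Sum>e\<in>E. real (w e) * ln (g (z(v := t)) e))" for t
    have "(h has_field_derivative (\<Sum>e\<in>E. real (w e) * (\<sigma> e * ?d e / g z e))) (at (z v))"
      unfolding h_def
    proof (intro DERIV_sum DERIV_cmult)
      fix e assume e: "e \<in> E"
      have "(ln has_field_derivative 1 / g z e) (at (g (z(v := z v)) e))"
        using DERIV_ln_divide[OF gz[OF e]] by simp
      from DERIV_chain2[OF this dg]
      show "((\<lambda>t. ln (g (z(v := t)) e)) has_field_derivative \<sigma> e * ?d e / g z e) (at (z v))"
        by simp
    qed
    moreover have "(\<Sum>e\<in>E. real (w e) * (\<sigma> e * ?d e / g z e)) = force E (\<lambda>e. real (w e)) z v"
      unfolding force_def by (intro sum.cong) (auto simp: g_def \<sigma>_def)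
    ultimately have D: "(h has_field_derivative force E (\<lambda>e. real (w e)) z v) (at (z v))" by simp
    have "\<forall>\<^sub>F t in nhds (z v). 0 < g (z(v := t)) e" if "e \<in> E" for e
    proof (rule order_tendstoD(1))
      have "isCont (\<lambda>t. g (z(v := t)) e) (z v)" using dg by (rule DERIV_isCont)
      then show "((\<lambda>t. g (z(v := t)) e) \<longlongrightarrow> g z e) (nhds (z v))"
        using tendsto_at_iff_tendsto_nhds[of "\<lambda>t. g (z(v := t)) e" "z v"] by (simp add: isCont_def)
    qed (rule gz[OF that])
    then have "\<forall>\<^sub>F t in nhds (z v). \<forall>e\<in>E. 0 < g (z(v := t)) e"
      using fin by (simp add: eventually_ball_finite_distrib)
    moreover have "\<forall>\<^sub>F t in nhds (z v). 0 < t \<and> t < 1"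
      using zv by (intro eventually_conj order_tendstoD[OF tendsto_ident_at] order_tendstoD[OF filterlim_ident])
    ultimately have "\<forall>\<^sub>F t in nhds (z v). h t \<le> h (z v)"
    proof eventually_elim
      case (elim t)
      have lnF: "ln (F x) = (\<Sum>e\<in>E. real (w e) * ln (g x e))" if "\<forall>e\<in>E. 0 < g x e" for x
        unfolding F_def using that by (subst ln_prod) (auto simp: fin ln_realpow)
      have "z(v := t) \<in> K" using z elim v by (auto simp: K_def less_imp_le PiE_iff)
      then have "F (z(v := t)) \<le> F z" by (rule max)
      moreover have "0 < F (z(v := t))" unfolding F_def using elim by (intro prod_pos) auto
      ultimately have "ln (F (z(v := t))) \<le> ln (F z)" by simp
      then show ?case using elim gz by (simp add: lnF h_def)
    qed
    then obtain r where "0 < r" "\<forall>t. \<bar>z v - t\<bar> < r \<longrightarrow> h t \<le> h (z v)"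
      unfolding eventually_nhds_metric by (auto simp: dist_real_def abs_minus_commute)
    then show ?thesis by (rule DERIV_local_max[OF D])
  qed
  moreover have "\<forall>(i, j)\<in>E. z i \<noteq> z j" using gz by (force simp: g_def)
  moreover have "z 1 = 0" "z 2 = 1" using z by (auto simp: K_def)
  ultimately have "equilibrium V E (\<lambda>e. real (w e)) z" by (simp add: equilibrium_def)
  with same show ?thesis by blast
qed

lemma force_uminus: "force E w (\<lambda>v. - y v) v = - force E w y v"
proof -
  have "a / (- s - - t) = - (a / (s - t))" for a s t :: 'a
  proof -
    have "- s - - t = - (s - t)" by simp
    then show ?thesis by (simp only: minus_divide_right)
  qed
  then have "(case e of (i, j) \<Rightarrow> w (i, j) * (of_bool (j = v) - of_bool (i = v)) / (- y j - - y i)) =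
      - (case e of (i, j) \<Rightarrow> w (i, j) * (of_bool (j = v) - of_bool (i = v)) / (y j - y i))" for e
    by (cases e) (simp only: prod.case)
  then show ?thesis
    unfolding force_def sum_negf[symmetric] by (intro sum.cong refl)
qed

text \<open>
  If all neighbours of \<open>v\<close> were above \<open>v\<close>, then all forces on \<open>v\<close> would point in the same direction.
\<close>

lemma lower_neighbor_of_zero_force:
  fixes w :: "nat \<times> nat \<Rightarrow> nat" and r :: "nat \<Rightarrow> real"
  assumes fin: "finite E" and w: "\<And>e. e \<in> E \<Longrightarrow> 0 < w e" and neq: "\<forall>(i, j)\<in>E. r i \<noteq> r j"
    and zero: "force E (\<lambda>e. real (w e)) r v = 0" and nb: "neighbors E v \<noteq> {}"
  shows "\<exists>u\<in>neighbors E v. r u < r v"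
proof (rule ccontr)
  assume no: "\<not> ?thesis"
  define f where "f = (\<lambda>(i, j). real (w (i, j)) * (of_bool (j = v) - of_bool (i = v)) / (r j - r i))"
  have neg: "f e < 0" if e: "e \<in> E" "fst e = v \<or> snd e = v" for e
  proof -
    obtain i j where ij: "e = (i, j)" by (cases e)
    have "r i \<noteq> r j" "0 < w (i, j)" using neq w e ij by auto
    moreover from this have "i \<noteq> j" by auto
    moreover have "r v \<le> r i" "r v \<le> r j"
      using no e ij by (auto simp: neighbors_def not_less)
    ultimately show ?thesis
      using e ij by (auto simp: f_def divide_less_0_iff zero_less_divide_iff)
  qed
  have "f e = 0" if "e \<in> E" "\<not> (fst e = v \<or> snd e = v)" for e
    using that by (cases e) (auto simp: f_def)
  then have nonpos: "f e \<le> 0" if "e \<in> E" for e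
    using neg[OF that] that by (cases "fst e = v \<or> snd e = v") (blast intro: less_imp_le eq_refl)+
  have "(\<Sum>e\<in>E. f e) = 0" using zero by (simp add: force_def f_def)
  then have "(\<Sum>e\<in>E. - f e) = 0" unfolding sum_negf by simp
  then have "\<forall>e\<in>E. - f e = 0"
    using sum_nonneg_eq_0_iff[OF fin, of "\<lambda>e. - f e"] nonpos by simp
  moreover obtain e where "e \<in> E" "fst e = v \<or> snd e = v"
    using nb by (auto simp: neighbors_def intro: that)
  ultimately show False using neg[of e] by force
qed

lemma force_of_real:
  "force E (\<lambda>e. of_nat (w e)) (\<lambda>v. complex_of_real (r v)) v = of_real (force E (\<lambda>e. real (w e)) r v)"
proof -
  have "complex_of_real (real a * (of_bool p - of_bool q) / (x - y)) =
      of_nat a * (of_bool p - of_bool q) / (of_real x - of_real y)" for a p q x y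
    by simp
  then show ?thesis
    unfolding force_def of_real_sum by (intro sum.cong) (auto simp del: of_real_divide of_real_mult)
qed

lemma equilibrium_of_real:
  "equilibrium V E (\<lambda>e. of_nat (w e)) (\<lambda>v. complex_of_real (r v)) \<longleftrightarrow> equilibrium V E (\<lambda>e. real (w e)) r"
  unfolding equilibrium_def force_of_real by simp

text \<open>
  The unique equilibrium equals its complex conjugate, so it is real. A vertex without
  neighbours could be moved freely, which uniqueness excludes; hence the equilibrium is bipolar. Any other
  bipolar orientation would have an equilibrium of its own.
\<close>

lemma unique_equilibrium_imp_unique_orientation:
  fixes w :: "nat \<times> nat \<Rightarrow> nat"
  assumes G: "based_graph V E" and w: "\<And>e. e \<in> E \<Longrightarrow> 0 < w e"
    and u: "unique_equilibrium V E (\<lambda>e. of_nat (w e))"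
  obtains r where "bipolar V E r" "\<And>z. bipolar V E z \<Longrightarrow> same_orientation E r z"
proof -
  let ?w = "\<lambda>e. of_nat (w e) :: complex"
  have fin: "finite E" using G by (rule based_graph_finite)
  from u obtain y where y: "y \<in> extensional V" "equilibrium V E ?w y"
    and only: "\<And>z. z \<in> extensional V \<Longrightarrow> equilibrium V E ?w z \<Longrightarrow> z = y"
    unfolding unique_equilibrium_def by blast
  have only': "z v = y v" if "equilibrium V E ?w z" "v \<in> V" for z v
  proof -
    have "equilibrium V E ?w (restrict z V) \<longleftrightarrow> equilibrium V E ?w z"
      by (rule equilibrium_cong[OF G]) simp
    with that have "restrict z V = y" by (intro only) auto
    then show ?thesis using that(2) by (metis restrict_apply')
  qed
  have "force E ?w (\<lambda>v. cnj (y v)) v = cnj (force E ?w y v)" for v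
    unfolding force_def cnj_sum by (intro sum.cong) auto
  then have "equilibrium V E ?w (\<lambda>v. cnj (y v))"
    using y(2) by (simp add: equilibrium_def)
  then have "cnj (y v) = y v" if "v \<in> V" for v
    using only' that by blast
  then have "y v = of_real (Re (y v))" if "v \<in> V" for v
    using that by (simp add: complex_eq_iff)
  moreover define r where "r v = Re (y v)" for v
  ultimately have yr: "y v = of_real (r v)" if "v \<in> V" for v
    using that by simp
  have "equilibrium V E ?w (\<lambda>v. of_real (r v)) \<longleftrightarrow> equilibrium V E ?w y"
    by (rule equilibrium_cong[OF G]) (simp add: yr)
  then have r: "equilibrium V E (\<lambda>e. real (w e)) r"
    using y(2) unfolding equilibrium_of_real by blast
  then have rneq: "\<forall>(i, j)\<in>E. r i \<noteq> r j" by (simp add: equilibrium_def)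
  have nb: "neighbors E v \<noteq> {}" if v: "v \<in> V - {1, 2}" for v
  proof
    assume "neighbors E v = {}"
    then have off: "i \<noteq> v" "j \<noteq> v" if "(i, j) \<in> E" for i j
      using that by (auto simp: neighbors_def)
    let ?z = "y(v := y v + 1)"
    have "force E ?w ?z x = force E ?w y x" for x
      unfolding force_def using off by (intro sum.cong) auto
    moreover have "\<forall>(i, j)\<in>E. ?z i \<noteq> ?z j"
    proof clarify
      fix i j assume "(i, j) \<in> E" "?z i = ?z j"
      then show False using off[of i j] y(2) by (auto simp: equilibrium_def)
    qed
    ultimately have "equilibrium V E ?w ?z"
      using y(2) v by (simp add: equilibrium_def)
    then have "?z v = y v" by (rule only') (use v in blast)
    then show False by simp
  qed
  have "bipolar V E r"
    unfolding bipolar_def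
  proof (intro conjI ballI)
    show "r 1 = 0" "r 2 = 1" using r by (simp_all add: equilibrium_def)
    show "case p of (i, j) \<Rightarrow> r i \<noteq> r j" if "p \<in> E" for p
      using rneq that by blast
  next
    fix v assume v: "v \<in> V - {1, 2}"
    have zero: "force E (\<lambda>e. real (w e)) r v = 0" using r v by (simp add: equilibrium_def)
    show "\<exists>u\<in>neighbors E v. r u < r v"
      by (rule lower_neighbor_of_zero_force[OF fin w rneq zero nb[OF v]])
    have "force E (\<lambda>e. real (w e)) (\<lambda>v. - r v) v = - force E (\<lambda>e. real (w e)) r v"
      by (rule force_uminus)
    then have "force E (\<lambda>e. real (w e)) (\<lambda>v. - r v) v = 0" using zero by simp
    moreover have "\<forall>(i, j)\<in>E. - r i \<noteq> - r j" using rneq by auto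
    ultimately have "\<exists>u\<in>neighbors E v. - r u < - r v"
      using lower_neighbor_of_zero_force[where w = w and r = "\<lambda>v. - r v", OF fin w _ _ nb[OF v]] by blast
    then show "\<exists>u\<in>neighbors E v. r v < r u" by simp
  qed
  moreover have "same_orientation E r z" if z: "bipolar V E z" for z
  proof -
    obtain x where x: "equilibrium V E (\<lambda>e. real (w e)) x" "same_orientation E z x"
      using orientation_has_equilibrium[where w = w, OF G z w] by blast
    have "x v = r v" if "v \<in> V" for v
      using only'[OF x(1)[folded equilibrium_of_real] that] yr[OF that] by simp
    then have "\<forall>(i, j)\<in>E. x i = r i \<and> x j = r j"
      using G by (auto simp: based_graph_def)
    then show ?thesis using x(2) by (fastforce simp: same_orientation_def)
  qed
  ultimately show ?thesis by (rule that)
qed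


section \<open>Minimal kinematics\<close>

lemma polynomial_functions_coordinate_poly:
  assumes "f \<in> polynomial_functions I"
  shows "\<exists>p. \<forall>t. f (s(i := t)) = poly p t"
  using assms
proof (induction rule: polynomial_functions.induct)
  case (const c)
  show ?case by (rule exI[of _ "[:c:]"]) simp
next
  case (var j)
  show ?case
    by (rule exI[of _ "if j = i then [:0, 1:] else [:s j:]"]) simp
next
  case (add f g)
  then obtain p q where "\<forall>t. f (s(i := t)) = poly p t" "\<forall>t. g (s(i := t)) = poly q t" by blast
  then show ?case by (intro exI[of _ "p + q"]) (simp only: poly_add simp_thms)
next
  case (mult f g)
  then obtain p q where "\<forall>t. f (s(i := t)) = poly p t" "\<forall>t. g (s(i := t)) = poly q t" by blast
  then show ?case by (intro exI[of _ "p * q"]) (simp only: poly_mult simp_thms)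
qed

text \<open>
  Restricted to one coordinate the function is a polynomial in one variable, which has only finitely
  many zeros if it is not zero. So the coordinates of a point where \<open>f\<close> does not vanish can be
  replaced by positive integers one at a time.
\<close>

lemma polynomial_functions_nonzero_at_positive:
  assumes f: "f \<in> polynomial_functions I" and s: "s \<in> I \<rightarrow>\<^sub>E UNIV" "f s \<noteq> 0" and I: "finite I"
  shows "\<exists>w :: 'i \<Rightarrow> nat. (\<forall>i\<in>I. 0 < w i) \<and> f (\<lambda>i\<in>I. of_nat (w i)) \<noteq> 0"
proof -
  have "\<exists>w :: 'i \<Rightarrow> nat. (\<forall>i\<in>J. 0 < w i) \<and> f (\<lambda>i. if i \<in> J then of_nat (w i) else s i) \<noteq> 0"
    if "finite J" "J \<subseteq> I" for J
    using that
  proof (induction J)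
    case empty
    then show ?case using s by simp
  next
    case (insert i J)
    then obtain w :: "'i \<Rightarrow> nat" where w: "\<forall>j\<in>J. 0 < w j"
      "f (\<lambda>j. if j \<in> J then of_nat (w j) else s j) \<noteq> 0" by auto
    define z where "z = (\<lambda>j. if j \<in> J then of_nat (w j) else s j)"
    obtain p where p: "f (z(i := t)) = poly p t" for t
      using polynomial_functions_coordinate_poly[OF f] by blast
    have "poly p (z i) \<noteq> 0"
      using w(2) p[of "z i"] by (simp add: z_def[symmetric])
    then have "p \<noteq> 0" by auto
    then have "finite {t. poly p t = 0}" by (rule poly_roots_finite)
    then have "finite (of_nat -` {t. poly p t = 0} :: nat set)"
      by (rule finite_vimageI) (simp add: inj_of_nat)
    then have "\<exists>m :: nat. m \<notin> insert 0 (of_nat -` {t. poly p t = 0})"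
      by (intro ex_new_if_finite) auto
    then obtain m :: nat where m: "0 < m" "poly p (of_nat m) \<noteq> 0" by auto
    have "z(i := of_nat m) = (\<lambda>j. if j \<in> insert i J then of_nat ((w(i := m)) j) else s j)"
      by (auto simp: z_def)
    then have "f (\<lambda>j. if j \<in> insert i J then of_nat ((w(i := m)) j) else s j) \<noteq> 0"
      using m(2) p[of "of_nat m"] by simp
    moreover have "\<forall>j\<in>insert i J. 0 < (w(i := m)) j" using w m by auto
    ultimately show ?case by blast
  qed
  from this[OF I subset_refl] obtain w :: "'i \<Rightarrow> nat" where
    w: "\<forall>i\<in>I. 0 < w i" "f (\<lambda>i. if i \<in> I then of_nat (w i) else s i) \<noteq> 0" by blast
  moreover have "(\<lambda>i. if i \<in> I then of_nat (w i) else s i) = (\<lambda>i\<in>I. of_nat (w i))"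
    using s(1) by (auto simp: PiE_def extensional_def)
  ultimately show ?thesis by auto
qed

lemma unique_equilibrium_base_weight:
  assumes "\<And>e. e \<in> E - {(1, 2)} \<Longrightarrow> w e = w' e"
  shows "unique_equilibrium V E w \<longleftrightarrow> unique_equilibrium V E w'"
proof -
  have "force E w y v = force E w' y v" if "v \<notin> {1, 2}" for y v
    unfolding force_def
  proof (intro sum.cong refl)
    fix e assume "e \<in> E"
    then show "(case e of (i, j) \<Rightarrow> w (i, j) * (of_bool (j = v) - of_bool (i = v)) / (y j - y i)) =
        (case e of (i, j) \<Rightarrow> w' (i, j) * (of_bool (j = v) - of_bool (i = v)) / (y j - y i))"
      using assms[of e] that by (cases e; cases "e = (1, 2)") auto
  qed
  then show ?thesis by (simp add: unique_equilibrium_def equilibrium_def)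
qed

lemma one_critical_point_imp_sub_two_tree:
  assumes n: "n \<ge> 4" and T: "T \<subseteq> S_index n" and one: "one_critical_point n T"
  shows "\<exists>E. two_tree {1..n-1} E \<and> insert (1, 2) T \<subseteq> E"
proof -
  have fin: "finite T" using T S_index_finite finite_subset by blast
  have G: "based_graph {1..n-1} (insert (1, 2) T)"
    using n T by (auto simp: based_graph_def S_index_def)
  obtain f where f: "f \<in> polynomial_functions T" and nonzero: "\<exists>s\<in>T \<rightarrow>\<^sub>E UNIV. f s \<noteq> 0"
    and good: "\<forall>s\<in>T \<rightarrow>\<^sub>E UNIV. f s \<noteq> 0 \<longrightarrow> (\<exists>!x. critical_point n T s x)"
    using one unfolding one_critical_point_def for_general_def by (rule bexE) (elim conjE, rule that)
  obtain s where s: "s \<in> T \<rightarrow>\<^sub>E UNIV" "f s \<noteq> 0" using nonzero by (elim bexE)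
  obtain w :: "nat \<times> nat \<Rightarrow> nat" where w: "\<forall>e\<in>T. 0 < w e"
    "f (\<lambda>e\<in>T. of_nat (w e)) \<noteq> 0"
    using polynomial_functions_nonzero_at_positive[OF f s fin] by (elim exE conjE)
  have "unique_equilibrium {1..n-1} (insert (1, 2) T) (\<lambda>e\<in>T. of_nat (w e))"
    unfolding one_critical_point_iff[OF n T, symmetric] by (rule good[rule_format]) (use w in auto)
  moreover have "unique_equilibrium {1..n-1} (insert (1, 2) T) (\<lambda>e\<in>T. of_nat (w e)) \<longleftrightarrow>
      unique_equilibrium {1..n-1} (insert (1, 2) T) (\<lambda>e. of_nat ((w((1, 2) := 1)) e))"
    by (rule unique_equilibrium_base_weight) auto
  ultimately have u: "unique_equilibrium {1..n-1} (insert (1, 2) T) (\<lambda>e. of_nat ((w((1, 2) := 1)) e))"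
    by blast
  have "0 < (w((1, 2) := 1)) e" if "e \<in> insert (1, 2) T" for e
    using w(1) that by auto
  then obtain r where "bipolar {1..n-1} (insert (1, 2) T) r"
    "\<And>z. bipolar {1..n-1} (insert (1, 2) T) z \<Longrightarrow> same_orientation (insert (1, 2) T) r z"
    using unique_equilibrium_imp_unique_orientation[OF G _ u] by blast
  from unique_orientation_imp_sub_two_tree[OF G this] show ?thesis .
qed

lemma two_tree_one_critical_point:
  assumes n: "n \<ge> 4" and E: "two_tree {1..n-1} E"
  shows "E - {(1, 2)} \<subseteq> S_index n" "one_critical_point n (E - {(1, 2)})"
proof -
  have G: "based_graph {1..n-1} E" by (rule two_tree_based_graph[OF E])
  then show T: "E - {(1, 2)} \<subseteq> S_index n"
    by (auto simp: based_graph_def S_index_def)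
  let ?T = "E - {(1, 2)}"
  have ins: "insert (1, 2) ?T = E" using G by (auto simp: based_graph_def)
  obtain P where P: "P \<in> polynomial_functions E"
    "\<And>w. (\<And>e. 0 < w e) \<Longrightarrow> P (\<lambda>e. of_nat (w e)) \<noteq> 0"
    "\<And>w. P w \<noteq> 0 \<Longrightarrow> unique_equilibrium {1..n-1} E w"
    using two_tree_generic_equilibrium[OF E] by blast
  let ?g = "\<lambda>s e. if e \<in> ?T then s e else 1 :: complex"
  show "one_critical_point n ?T"
    unfolding one_critical_point_def for_general_def
  proof (intro bexI conjI ballI impI)
    show "(\<lambda>s. P (?g s)) \<in> polynomial_functions ?T"
    proof (rule polynomial_functions_compose[OF P(1)])
      fix e
      show "(\<lambda>s. ?g s e) \<in> polynomial_functions ?T"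
        by (cases "e \<in> ?T") (auto intro: polynomial_functions.const polynomial_functions.var)
    qed
    show "P (?g (\<lambda>e\<in>?T. 1)) \<noteq> 0"
    proof -
      have "?g (\<lambda>e\<in>?T. 1) = (\<lambda>e. of_nat 1)" by auto
      then show ?thesis using P(2)[of "\<lambda>_. 1"] by simp
    qed
    show "(\<lambda>e\<in>?T. 1) \<in> ?T \<rightarrow>\<^sub>E UNIV" by simp
  next
    fix s assume "P (?g s) \<noteq> 0"
    then have "unique_equilibrium {1..n-1} E (?g s)" by (rule P(3))
    moreover have "unique_equilibrium {1..n-1} E (?g s) \<longleftrightarrow> unique_equilibrium {1..n-1} E s"
      by (rule unique_equilibrium_base_weight) auto
    ultimately show "\<exists>!x. critical_point n ?T s x"
      unfolding one_critical_point_iff[OF n T] ins by blast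
  qed
qed

lemma two_tree_card:
  assumes "two_tree V E"
  shows "card E + 3 = 2 * card V"
  using assms
proof (induction rule: two_tree.induct)
  case single_edge
  then show ?case by simp
next
  case (attach V E i j k)
  from two_tree_based_graph[OF attach(1)] have G: "based_graph V E" .
  then have ij: "i \<in> V" "j \<in> V" "i < j" and fin: "finite V"
    using attach by (auto simp: based_graph_def)
  have "edge i k \<notin> E" "edge j k \<notin> E"
    using G attach(3) by (auto simp: based_graph_def edge_def min_def max_def)
  moreover have "edge i k \<noteq> edge j k"
    using ij attach(3) by (auto simp: edge_def min_def max_def split: if_splits)
  ultimately have "card (E \<union> {edge i k, edge j k}) = card E + 2"
    using based_graph_finite[OF G] by simp
  then show ?case using attach fin by simp
qed

lemma two_tree_maximal:
  assumes "two_tree V E" "two_tree V E'" "E \<subseteq> E'"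
  shows "E = E'"
proof (rule card_subset_eq[OF _ assms(3)])
  show "finite E'" using assms(2) two_tree_based_graph based_graph_finite by blast
  show "card E = card E'" using assms(1,2) two_tree_card by (metis add_right_cancel)
qed

theorem theorem1p4:
  fixes n :: nat
  assumes "n \<ge> 4"
  shows "bij_betw (\<lambda>E. E - {(1, 2)}) (two_trees (n - 1)) {T. minimal_kinematics n T}"
proof -
  have base: "(1, 2) \<in> E" if "two_tree {1..n-1} E" for E
    using two_tree_based_graph[OF that] by (simp add: based_graph_def)
  note sub = one_critical_point_imp_sub_two_tree[OF assms]
  note tree = two_tree_one_critical_point[OF assms]
  have "inj_on (\<lambda>E. E - {(1, 2)}) (two_trees (n - 1))"
  proof (rule inj_onI)
    fix E E' :: "(nat \<times> nat) set"
    assume "E \<in> two_trees (n - 1)" "E' \<in> two_trees (n - 1)" and eq: "E - {(1, 2)} = E' - {(1, 2)}"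
    then have "(1, 2) \<in> E" "(1, 2) \<in> E'" using base by (simp_all add: two_trees_def)
    with eq show "E = E'" by blast
  qed
  moreover have "E - {(1, 2)} \<in> {T. minimal_kinematics n T}" if E: "E \<in> two_trees (n - 1)" for E
  proof -
    have E: "two_tree {1..n-1} E" using E by (simp add: two_trees_def)
    have "\<not> one_critical_point n T'" if T': "E - {(1, 2)} \<subset> T'" "T' \<subseteq> S_index n" for T'
    proof
      assume "one_critical_point n T'"
      then obtain E' where E': "two_tree {1..n-1} E'" "insert (1, 2) T' \<subseteq> E'"
        using sub[OF T'(2)] by blast
      have "E = E'"
        by (rule two_tree_maximal[OF E E'(1)]) (use E' T' in blast)
      moreover have "(1, 2) \<notin> T'" using T'(2) by (auto simp: S_index_def)
      ultimately show False using T'(1) E'(2) by blast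
    qed
    then show ?thesis using tree[OF E] by (simp add: minimal_kinematics_def)
  qed
  moreover have "T \<in> (\<lambda>E. E - {(1, 2)}) ` two_trees (n - 1)" if "T \<in> {T. minimal_kinematics n T}" for T
  proof -
    have T: "T \<subseteq> S_index n" "one_critical_point n T"
      and max: "\<And>T'. T \<subset> T' \<Longrightarrow> T' \<subseteq> S_index n \<Longrightarrow> \<not> one_critical_point n T'"
      using that by (auto simp: minimal_kinematics_def)
    obtain E where E: "two_tree {1..n-1} E" "insert (1, 2) T \<subseteq> E"
      using sub[OF T] by blast
    have "(1, 2) \<notin> T" using T(1) by (auto simp: S_index_def)
    then have "T \<subseteq> E - {(1, 2)}" using E(2) by blast
    then have "T = E - {(1, 2)}" using max tree[OF E(1)] by blast
    then show ?thesis using E(1) by (simp add: two_trees_def)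
  qed
  ultimately show ?thesis unfolding bij_betw_def by blast
qed

end
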